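(* Let $k,k_1,k_2,k_3\in\mathbb{Z}_{\geq0}$. For each of the following six data (equation; exchange matrix $B$; exchange polynomials $\mathbf{Z}=(Z_1,Z_2,Z_3)$; $D$; tree), consider the generalized cluster pattern $CP_{(\mathbf{x},B,\mathbf{Z})}$ of rank $3$ with initial seed $(\mathbf{x},B,\mathbf{Z})$, $\mathbf{x}=(x_1,x_2,x_3)$, and for each vertex $t\in\mathbb{T}_3$ let $(x_{1;t},x_{2;t},x_{3;t})$ be its cluster, specialized by substituting $x_1=x_2=x_3=1$: (i) $x^2+y^2+z^2=3xyz$; $B=\begin{bmatrix}0&2&-2\\-2&0&2\\2&-2&0\end{bmatrix}$; $Z_1=Z_2=Z_3=1+u$; $D=I_3$; tree $\mathbb{T}^{0,0,0}$. (ii) $x^2+y^2+z^2+k_1xy=(3+k_1)xyz$; $B=\begin{bmatrix}0&2&-1\\-2&0&1\\2&-2&0\end{bmatrix}$; $Z_1=Z_2=1+u$, $Z_3=1+k_1u+u^2$; $D=\mathrm{diag}(1,1,2)$; tree $\mathbb{T}^{k_1,0,0}$. (iii) $x^2+y^2+z^2+k_1xy+k_2yz=(3+k_1+k_2)xyz$; $B=\begin{bmatrix}0&2&-1\\-1&0&1\\1&-2&0\end{bmatrix}$; $Z_1=1+k_2u+u^2$, $Z_2=1+u$, $Z_3=1+k_1u+u^2$; $D=\mathrm{diag}(2,1,2)$; tree $\mathbb{T}^{k_1,k_2,0}$. (iv) $x^2+y^2+z^2+k_1xy+k_2yz+k_3zx=(3+k_1+k_2+k_3)xyz$; $B=\begin{bmatrix}0&1&-1\\-1&0&1\\1&-1&0\end{bmatrix}$;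 $Z_1=1+k_2u+u^2$, $Z_2=1+k_3u+u^2$, $Z_3=1+k_1u+u^2$; $D=\mathrm{diag}(2,2,2)$; tree $\mathbb{T}^{k_1,k_2,k_3}$. (v) $x^2+y^4+z^4+2xy^2+2z^2x=7xy^2z^2$; $B=\begin{bmatrix}0&1&-1\\-4&0&2\\4&-2&0\end{bmatrix}$; $Z_1=Z_2=Z_3=1+u$; $D=I_3$; tree $\mathbb{T}^{0}$. (vi) $x^2+y^4+z^4+2xy^2+ky^2z^2+2z^2x=(7+k)xy^2z^2$; $B=\begin{bmatrix}0&1&-1\\-2&0&2\\2&-2&0\end{bmatrix}$; $Z_1=1+ku+u^2$, $Z_2=Z_3=1+u$; $D=\mathrm{diag}(2,1,1)$; tree $\mathbb{T}^{k}$. Then in each case, ignoring exchange matrices and exchange polynomials and keeping only clusters, the specialized clusters of $CP_{(\mathbf{x},B,\mathbf{Z})}$ give the indicated tree (whose vertices are the positive integer solutions of the corresponding equation): the assignment $t\mapsto(x_{1;t},x_{2;t},x_{3;t})|_{x_1=x_2=x_3=1}$ sends the rooted vertex $t_0$ to $(1,1,1)$ and identifies $\mathbb{T}_3$ with the indicated tree as trees.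
   Context: Generalized cluster patterns (rank $n$). Let $\mathcal{F}$ be the field of rational functions in $n$ indeterminates. A labeled seed is a triple $(\mathbf{x},B,\mathbf{Z})$ where $\mathbf{x}=(x_1,\dots,x_n)$ is a free generating set of $\mathcal{F}$, $B=(b_{ij})$ is an $n\times n$ skew-symmetrizable integer matrix (some positive diagonal integer matrix $S$ makes $SB$ skew-symmetric), and $\mathbf{Z}=(Z_1,\dots,Z_n)$ with $Z_i(u)=z_{i,0}+z_{i,1}u+\dots+z_{i,d_i}u^{d_i}$, coefficients in $\mathbb{R}_{>0}$, $z_{i,0}=z_{i,d_i}=1$; $D=\mathrm{diag}(d_1,\dots,d_n)$. Write $[b]_+=\max(b,0)$. The mutation $\mu_k$ ($1\le k\le n$) sends $(\mathbf{x},B,\mathbf{Z})$ to $(\mathbf{x}',B',\mathbf{Z}')$ where $b'_{ij}=-b_{ij}$ if $i=k$ or $j=k$, and $b'_{ij}=b_{ij}+d_k([b_{ik}]_+b_{kj}+b_{ik}[-b_{kj}]_+)$ otherwise; $x'_k=\left(\prod_{i}x_i^{[-b_{ik}]_+}\right)^{d_k}Z_k\!\left(\prod_i x_i^{b_{ik}}\right)/x_k$ and $x'_j=x_j$ for $j\ne k$; $Z'_k(u)=u^{d_k}Z_k(u^{-1})$ and $Z'_j=Z_j$ for $j\neq k$. Let $\mathbb{T}_n$ be the $n$-regular tree with edges labeled $1,\dots,n$ so that the $n$ edges at each vertex have distinct labels, and fix a rooted vertex $t_0$. The generalized cluster pattern $CP_{(\mathbf{x},B,\mathbf{Z})}$ assigns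 a labeled seed $\Sigma_t=(\mathbf{x}_t,B_t,\mathbf{Z}_t)$, $\mathbf{x}_t=(x_{1;t},\dots,x_{n;t})$, to each $t\in\mathbb{T}_n$ with $\Sigma_{t_0}=(\mathbf{x},B,\mathbf{Z})$ and $\Sigma_{t'}=\mu_k(\Sigma_t)$ whenever $t,t'$ are joined by an edge labeled $k$. Trees of triplets. For $k_1,k_2,k_3\in\mathbb{Z}_{\ge0}$, $\mathbb{T}^{k_1,k_2,k_3}$ has root $(1,1,1)$ whose three children are $(k_2+2,1,1),(1,k_3+2,1),(1,1,k_1+2)$; every other vertex $(a,b,c)$ has two children: if $a$ is maximal in $(a,b,c)$, they are $(a,\frac{a^2+k_3ac+c^2}{b},c)$ and $(a,b,\frac{a^2+k_1ab+b^2}{c})$; if $b$ is maximal, $(\frac{b^2+k_2bc+c^2}{a},b,c)$ and $(a,b,\frac{a^2+k_1ab+b^2}{c})$; if $c$ is maximal, $(\frac{b^2+k_2bc+c^2}{a},b,c)$ and $(a,\frac{a^2+k_3ac+c^2}{b},c)$. For $k\in\mathbb{Z}_{\ge0}$, $\mathbb{T}^k$ has root $(1,1,1)$ whose three children are $(k+2,1,1),(1,2,1),(1,1,2)$; every other vertex $(a,b,c)$ has two children: if $a$ is maximal in $(a,b^2,c^2)$, they are $(a,\frac{a+c^2}{b},c)$ and $(a,b,\frac{a+b^2}{c})$; if $b^2$ is maximal, $(\frac{b^4+kb^2c^2+c^4}{a},b,c)$ and $(a,b,\frac{a+b^2}{c})$; if $c^2$ is maximal, $(\frac{b^4+kb^2c^2+c^4}{a},b,c)$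 and $(a,\frac{a+c^2}{b},c)$. *)

theory Defs
  imports
    "HOL-Analysis.Analysis"
    "HOL-Computational_Algebra.Computational_Algebra"
    "HOL-Library.Poly_Mapping"
begin

section \<open>Rational functions in indeterminates indexed by a finite type\<close>

text \<open>
  The rank is the cardinality of the index type. The order on the index type plays no
  mathematical role; the library needs it to show that polynomials form an integral domain.
  The ground field is the field of real numbers, since exchange polynomials have real coefficients.
\<close>

instance poly_mapping :: ("{ordered_cancel_comm_monoid_add, linorder}", idom) idom ..

type_synonym 'n mpoly = "('n \<Rightarrow>\<^sub>0 nat) \<Rightarrow>\<^sub>0 real"
type_synonym 'n ratfun = "'n mpoly fract"
type_synonym 'n cluster = "'n ratfun ^ 'n"
type_synonym 'n exchange_matrix = "int ^ 'n ^ 'n"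

definition ratfun_const :: "real \<Rightarrow> 'n::{finite,linorder} ratfun" where
  "ratfun_const r = to_fract (Poly_Mapping.single 0 r)"

text \<open>The value of \<open>P\<close> at \<open>x\<close>, coefficients being mapped into the target ring by \<open>c\<close>.\<close>

definition mpoly_eval ::
  "(real \<Rightarrow> 'a::comm_ring_1) \<Rightarrow> 'a ^ 'n \<Rightarrow> 'n mpoly \<Rightarrow> 'a" where
  "mpoly_eval c x P =
     (\<Sum>m\<in>Poly_Mapping.keys P.
        c (Poly_Mapping.lookup P m) * (\<Prod>i\<in>UNIV. x $ i ^ Poly_Mapping.lookup m i))"

text \<open>Algebraically independent elements that generate the whole field over the reals.\<close>

definition free_generating_set :: "('n::{finite,linorder}) cluster \<Rightarrow> bool" where
  "free_generating_set x \<longleftrightarrow>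
     (\<forall>P. mpoly_eval ratfun_const x P = 0 \<longrightarrow> P = 0) \<and>
     (\<forall>f. \<exists>P Q. mpoly_eval ratfun_const x Q \<noteq> 0 \<and>
               f = mpoly_eval ratfun_const x P / mpoly_eval ratfun_const x Q)"

text \<open>
  \<open>specializes x p f v\<close>: the element \<open>f\<close>, written as a rational function in \<open>x\<close>, is defined
  under the substitution of \<open>p\<close> for \<open>x\<close> and takes the value \<open>v\<close>.
  If \<open>x\<close> is a free generating set, then \<open>v\<close> is unique.
\<close>

definition specializes ::
  "('n::{finite,linorder}) cluster \<Rightarrow> real ^ ('n::{finite,linorder}) \<Rightarrow> 'n ratfun \<Rightarrow> real \<Rightarrow> bool" where
  "specializes x p f v \<longleftrightarrow>
     (\<exists>P Q. mpoly_eval id p Q \<noteq> 0 \<and>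
            f = mpoly_eval ratfun_const x P / mpoly_eval ratfun_const x Q \<and>
            v = mpoly_eval id p P / mpoly_eval id p Q)"


section \<open>Labeled seeds and mutations\<close>

text \<open>A triple consisting of a cluster, an exchange matrix and the exchange polynomials.\<close>

type_synonym 'n seed = "'n cluster \<times> 'n exchange_matrix \<times> (real poly ^ 'n)"

definition skew_symmetrizable :: "'n::finite exchange_matrix \<Rightarrow> bool" where
  "skew_symmetrizable B \<longleftrightarrow>
     (\<exists>S :: 'n exchange_matrix.
        (\<forall>i j. i \<noteq> j \<longrightarrow> S $ i $ j = 0) \<and> (\<forall>i. 0 < S $ i $ i) \<and>
        transpose (S ** B) = - (S ** B))"

text \<open>
  Zero is allowed for the inner coefficients, so that \<open>1 + k u + u\<^sup>2\<close> with \<open>k = 0\<close> is an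
  exchange polynomial.
\<close>

definition exchange_poly :: "real poly \<Rightarrow> bool" where
  "exchange_poly p \<longleftrightarrow> coeff p 0 = 1 \<and> lead_coeff p = 1 \<and> (\<forall>j. 0 \<le> coeff p j)"

fun labeled_seed :: "('n::{finite,linorder}) seed \<Rightarrow> bool" where
  "labeled_seed (x, B, Z) \<longleftrightarrow>
     free_generating_set x \<and> skew_symmetrizable B \<and> (\<forall>i. exchange_poly (Z $ i))"

text \<open>The diagonal entries of \<open>D\<close>.\<close>

definition exchange_degrees :: "real poly ^ 'n \<Rightarrow> nat ^ 'n" where
  "exchange_degrees Z = (\<chi> i. degree (Z $ i))"

definition pos_part :: "int \<Rightarrow> int" where
  "pos_part b = max b 0"

definition matrix_mutation :: "'n \<Rightarrow> nat \<Rightarrow> 'n exchange_matrix \<Rightarrow> 'n::finite exchange_matrix" where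
  "matrix_mutation k d B = (\<chi> i j.
     if i = k \<or> j = k then - B $ i $ j
     else B $ i $ j
            + int d * (pos_part (B $ i $ k) * B $ k $ j + B $ i $ k * pos_part (- B $ k $ j)))"

definition cluster_mutation ::
  "'n \<Rightarrow> ('n::{finite,linorder}) cluster \<Rightarrow> 'n exchange_matrix \<Rightarrow> real poly \<Rightarrow> 'n cluster" where
  "cluster_mutation k x B p = (\<chi> j.
     if j = k then
       (\<Prod>i\<in>UNIV. x $ i powi pos_part (- B $ i $ k)) ^ degree p
         * poly (map_poly ratfun_const p) (\<Prod>i\<in>UNIV. x $ i powi (B $ i $ k)) / x $ k
     else x $ j)"

text \<open>Since the constant coefficient of \<open>p\<close> is not zero, \<open>reflect_poly p\<close> is \<open>u\<^sup>d p(1/u)\<close>.\<close>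

definition poly_mutation :: "'n \<Rightarrow> real poly ^ 'n \<Rightarrow> real poly ^ 'n" where
  "poly_mutation k Z = (\<chi> j. if j = k then reflect_poly (Z $ k) else Z $ j)"

fun seed_mutation :: "'n \<Rightarrow> ('n::{finite,linorder}) seed \<Rightarrow> 'n seed" where
  "seed_mutation k (x, B, Z) =
     (cluster_mutation k x B (Z $ k), matrix_mutation k (degree (Z $ k)) B, poly_mutation k Z)"


section \<open>Trees and cluster patterns\<close>

text \<open>A simple graph is given by its vertex set \<open>V\<close> and its symmetric adjacency relation \<open>R\<close>.\<close>

definition is_tree :: "'v set \<Rightarrow> ('v \<times> 'v) set \<Rightarrow> bool" where
  "is_tree V R \<longleftrightarrow>
     V \<noteq> {} \<and> R \<subseteq> V \<times> V \<and> sym R \<and> irrefl R \<and>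
     (\<forall>u\<in>V. \<forall>v\<in>V. (u, v) \<in> R\<^sup>*) \<and>
     \<not> (\<exists>p. 3 \<le> length p \<and> distinct p \<and> successively (\<lambda>u v. (u, v) \<in> R) p
            \<and> (last p, hd p) \<in> R)"

definition labeled_regular_tree ::
  "'v set \<Rightarrow> ('v \<times> 'v) set \<Rightarrow> ('v \<Rightarrow> 'v \<Rightarrow> 'n::finite) \<Rightarrow> bool" where
  "labeled_regular_tree V R lab \<longleftrightarrow>
     is_tree V R \<and>
     (\<forall>u v. (u, v) \<in> R \<longrightarrow> lab u v = lab v u) \<and>
     (\<forall>v\<in>V. card {w. (v, w) \<in> R} = CARD('n) \<and> inj_on (lab v) {w. (v, w) \<in> R})"

definition cluster_pattern ::
  "'v set \<Rightarrow> ('v \<times> 'v) set \<Rightarrow> ('v \<Rightarrow> 'v \<Rightarrow> 'n) \<Rightarrow> 'v \<Rightarrow> ('n::{finite,linorder}) seed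
     \<Rightarrow> ('v \<Rightarrow> 'n seed) \<Rightarrow> bool" where
  "cluster_pattern V R lab t0 s \<sigma> \<longleftrightarrow>
     (\<forall>t\<in>V. labeled_seed (\<sigma> t)) \<and> \<sigma> t0 = s \<and>
     (\<forall>t t'. (t, t') \<in> R \<longrightarrow> \<sigma> t' = seed_mutation (lab t t') (\<sigma> t))"

definition graph_iso ::
  "'v set \<Rightarrow> ('v \<times> 'v) set \<Rightarrow> 'w set \<Rightarrow> ('w \<times> 'w) set \<Rightarrow> ('v \<Rightarrow> 'w) \<Rightarrow> bool" where
  "graph_iso V R W Q f \<longleftrightarrow>
     bij_betw f V W \<and> (\<forall>u\<in>V. \<forall>v\<in>V. (u, v) \<in> R \<longleftrightarrow> (f u, f v) \<in> Q)"


section \<open>Trees of triplets\<close>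

text \<open>
  Triplets are taken over the reals, so that the quotients in the rules below are exact and
  integrality of the vertices is not presupposed.
\<close>

type_synonym triplet = "real \<times> real \<times> real"

inductive triplet_child :: "nat \<Rightarrow> nat \<Rightarrow> nat \<Rightarrow> triplet \<Rightarrow> triplet \<Rightarrow> bool"
  for k1 k2 k3 :: nat where
  root_1: "triplet_child k1 k2 k3 (1, 1, 1) (real k2 + 2, 1, 1)"
| root_2: "triplet_child k1 k2 k3 (1, 1, 1) (1, real k3 + 2, 1)"
| root_3: "triplet_child k1 k2 k3 (1, 1, 1) (1, 1, real k1 + 2)"
| a_max_2: "(a, b, c) \<noteq> (1, 1, 1) \<Longrightarrow> a = Max {a, b, c} \<Longrightarrow>
    triplet_child k1 k2 k3 (a, b, c) (a, (a\<^sup>2 + real k3 * a * c + c\<^sup>2) / b, c)"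
| a_max_3: "(a, b, c) \<noteq> (1, 1, 1) \<Longrightarrow> a = Max {a, b, c} \<Longrightarrow>
    triplet_child k1 k2 k3 (a, b, c) (a, b, (a\<^sup>2 + real k1 * a * b + b\<^sup>2) / c)"
| b_max_1: "(a, b, c) \<noteq> (1, 1, 1) \<Longrightarrow> b = Max {a, b, c} \<Longrightarrow>
    triplet_child k1 k2 k3 (a, b, c) ((b\<^sup>2 + real k2 * b * c + c\<^sup>2) / a, b, c)"
| b_max_3: "(a, b, c) \<noteq> (1, 1, 1) \<Longrightarrow> b = Max {a, b, c} \<Longrightarrow>
    triplet_child k1 k2 k3 (a, b, c) (a, b, (a\<^sup>2 + real k1 * a * b + b\<^sup>2) / c)"
| c_max_1: "(a, b, c) \<noteq> (1, 1, 1) \<Longrightarrow> c = Max {a, b, c} \<Longrightarrow>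
    triplet_child k1 k2 k3 (a, b, c) ((b\<^sup>2 + real k2 * b * c + c\<^sup>2) / a, b, c)"
| c_max_2: "(a, b, c) \<noteq> (1, 1, 1) \<Longrightarrow> c = Max {a, b, c} \<Longrightarrow>
    triplet_child k1 k2 k3 (a, b, c) (a, (a\<^sup>2 + real k3 * a * c + c\<^sup>2) / b, c)"

inductive sq_triplet_child :: "nat \<Rightarrow> triplet \<Rightarrow> triplet \<Rightarrow> bool"
  for k :: nat where
  sq_root_1: "sq_triplet_child k (1, 1, 1) (real k + 2, 1, 1)"
| sq_root_2: "sq_triplet_child k (1, 1, 1) (1, 2, 1)"
| sq_root_3: "sq_triplet_child k (1, 1, 1) (1, 1, 2)"
| sq_a_max_2: "(a, b, c) \<noteq> (1, 1, 1) \<Longrightarrow> a = Max {a, b\<^sup>2, c\<^sup>2} \<Longrightarrow>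
    sq_triplet_child k (a, b, c) (a, (a + c\<^sup>2) / b, c)"
| sq_a_max_3: "(a, b, c) \<noteq> (1, 1, 1) \<Longrightarrow> a = Max {a, b\<^sup>2, c\<^sup>2} \<Longrightarrow>
    sq_triplet_child k (a, b, c) (a, b, (a + b\<^sup>2) / c)"
| sq_b_max_1: "(a, b, c) \<noteq> (1, 1, 1) \<Longrightarrow> b\<^sup>2 = Max {a, b\<^sup>2, c\<^sup>2} \<Longrightarrow>
    sq_triplet_child k (a, b, c) ((b^4 + real k * b\<^sup>2 * c\<^sup>2 + c^4) / a, b, c)"
| sq_b_max_3: "(a, b, c) \<noteq> (1, 1, 1) \<Longrightarrow> b\<^sup>2 = Max {a, b\<^sup>2, c\<^sup>2} \<Longrightarrow>
    sq_triplet_child k (a, b, c) (a, b, (a + b\<^sup>2) / c)"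
| sq_c_max_1: "(a, b, c) \<noteq> (1, 1, 1) \<Longrightarrow> c\<^sup>2 = Max {a, b\<^sup>2, c\<^sup>2} \<Longrightarrow>
    sq_triplet_child k (a, b, c) ((b^4 + real k * b\<^sup>2 * c\<^sup>2 + c^4) / a, b, c)"
| sq_c_max_2: "(a, b, c) \<noteq> (1, 1, 1) \<Longrightarrow> c\<^sup>2 = Max {a, b\<^sup>2, c\<^sup>2} \<Longrightarrow>
    sq_triplet_child k (a, b, c) (a, (a + c\<^sup>2) / b, c)"

text \<open>The vertices and the (undirected) edges of the tree with root \<open>(1, 1, 1)\<close>.\<close>

definition triplets :: "(triplet \<Rightarrow> triplet \<Rightarrow> bool) \<Rightarrow> triplet set" where
  "triplets child = {v. child\<^sup>*\<^sup>* (1, 1, 1) v}"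

definition triplet_edges :: "(triplet \<Rightarrow> triplet \<Rightarrow> bool) \<Rightarrow> (triplet \<times> triplet) set" where
  "triplet_edges child =
     {(v, w). v \<in> triplets child \<and> w \<in> triplets child \<and> (child v w \<or> child w v)}"

definition positive_solutions :: "(int \<Rightarrow> int \<Rightarrow> int \<Rightarrow> bool) \<Rightarrow> triplet set" where
  "positive_solutions eqn =
     {(of_int x, of_int y, of_int z) | x y z. 0 < x \<and> 0 < y \<and> 0 < z \<and> eqn x y z}"


section \<open>Specialized clusters giving a tree of triplets\<close>

text \<open>
  The function \<open>\<phi>\<close> is the assignment of the specialized cluster to a vertex; it is
  unique on \<open>V\<close> because specialized values are.
\<close>

definition specialized_clusters_give_tree ::
  "'v set \<Rightarrow> ('v \<times> 'v) set \<Rightarrow> 'v \<Rightarrow> 3 cluster \<Rightarrow> ('v \<Rightarrow> 3 seed)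
     \<Rightarrow> (triplet \<Rightarrow> triplet \<Rightarrow> bool) \<Rightarrow> bool" where
  "specialized_clusters_give_tree V R t0 x \<sigma> child \<longleftrightarrow>
     (\<exists>\<phi> :: 'v \<Rightarrow> triplet.
        (\<forall>t\<in>V. case \<phi> t of (a, b, c) \<Rightarrow>
            specializes x (vector [1, 1, 1]) (fst (\<sigma> t) $ 1) a \<and>
            specializes x (vector [1, 1, 1]) (fst (\<sigma> t) $ 2) b \<and>
            specializes x (vector [1, 1, 1]) (fst (\<sigma> t) $ 3) c) \<and>
        \<phi> t0 = (1, 1, 1) \<and>
        graph_iso V R (triplets child) (triplet_edges child) \<phi>)"

text \<open>
  The claim for one datum (\<open>B\<close>, \<open>Z\<close>, the diagonal \<open>d\<close> of \<open>D\<close>, the tree, the equation).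
\<close>

definition pattern_gives_tree ::
  "'v set \<Rightarrow> ('v \<times> 'v) set \<Rightarrow> ('v \<Rightarrow> 'v \<Rightarrow> 3) \<Rightarrow> 'v \<Rightarrow> 3 cluster
     \<Rightarrow> 3 exchange_matrix \<Rightarrow> real poly ^ 3 \<Rightarrow> nat ^ 3
     \<Rightarrow> (triplet \<Rightarrow> triplet \<Rightarrow> bool) \<Rightarrow> (int \<Rightarrow> int \<Rightarrow> int \<Rightarrow> bool) \<Rightarrow> bool" where
  "pattern_gives_tree V R lab t0 x B Z d child eqn \<longleftrightarrow>
     labeled_seed (x, B, Z) \<and> exchange_degrees Z = d \<and>
     triplets child = positive_solutions eqn \<and>
     (\<forall>\<sigma>. cluster_pattern V R lab t0 (x, B, Z) \<sigma> \<longrightarrow>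
           specialized_clusters_give_tree V R t0 x \<sigma> child)"

end

theory Submission
  imports Defs
begin

text \<open>
  Mutation only changes the sign of each of the six exchange matrices, and the exchange polynomials
  are palindromic, so every seed of the pattern is \<open>(x\<^sub>t, \<plusminus>B, Z)\<close> and the exchange relations are the
  same everywhere. Specialized at \<open>(1, 1, 1)\<close>, they are the Vieta involutions of the corresponding
  equation, which is quadratic in each variable; the data with fourth powers reduce to
  those of the fourth kind by squaring the last two variables. A solution other than \<open>(1, 1, 1)\<close> has
  a strictly largest entry; the involution at this entry decreases the sum of the entries, and
  the two others increase it and make their new entry the largest. Hence all solutions
  descend to \<open>(1, 1, 1)\<close>, and a path without backtracking in the regular tree, which ascends from
  \<open>(1, 1, 1)\<close>, never returns to it.
\<close>

section \<open>Evaluation and specialization\<close>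

text \<open>Evaluation is needed with two coefficient maps, \<open>id\<close> into the reals and
  \<open>ratfun_const\<close> into the rational functions; its ring laws are proved once for
  both.\<close>

locale real_algebra_hom =
  fixes c :: "real \<Rightarrow> 'a::comm_ring_1"
  assumes hom_add: "c (r + s) = c r + c s"
    and hom_mult: "c (r * s) = c r * c s"
    and hom_one: "c 1 = 1"
begin

lemma hom_zero: "c 0 = 0"
  using hom_add [of 0 0] by simp

text \<open>Cancellation can shrink the support of a sum of polynomials, so additivity is proved
  over a common superset of the supports; the extra terms vanish because
  \<open>c 0 = 0\<close>.\<close>

lemma mpoly_eval_superset:
  assumes "finite S" "Poly_Mapping.keys P \<subseteq> S"
  shows "mpoly_eval c x P =
    (\<Sum>m\<in>S. c (Poly_Mapping.lookup P m) * (\<Prod>i\<in>UNIV. x $ i ^ Poly_Mapping.lookup m i))"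
  unfolding mpoly_eval_def
  using assms by (intro sum.mono_neutral_left) (auto simp: in_keys_iff hom_zero)

lemma mpoly_eval_add: "mpoly_eval c x (P + Q) = mpoly_eval c x P + mpoly_eval c x Q"
proof -
  let ?S = "Poly_Mapping.keys P \<union> Poly_Mapping.keys Q"
  have "Poly_Mapping.keys (P + Q) \<subseteq> ?S"
    by (rule Poly_Mapping.keys_add)
  then show ?thesis
    by (simp add: mpoly_eval_superset [of ?S] lookup_add hom_add sum.distrib distrib_right)
qed

lemma mpoly_eval_zero: "mpoly_eval c x 0 = 0"
  by (simp add: mpoly_eval_def)

lemma mpoly_eval_sum: "mpoly_eval c x (sum f A) = (\<Sum>a\<in>A. mpoly_eval c x (f a))"
  by (induction A rule: infinite_finite_induct) (simp_all add: mpoly_eval_zero mpoly_eval_add)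

lemma mpoly_eval_single:
  "mpoly_eval c x (Poly_Mapping.single m r) = c r * (\<Prod>i\<in>UNIV. x $ i ^ Poly_Mapping.lookup m i)"
  by (subst mpoly_eval_superset [of "{m}"]) auto

lemma mpoly_eval_const: "mpoly_eval c x (Poly_Mapping.single 0 r) = c r"
  by (simp add: mpoly_eval_single)

lemma mpoly_eval_one: "mpoly_eval c x 1 = 1"
  using mpoly_eval_const [of x 1] by (simp add: hom_one)

lemma mpoly_eval_var:
  fixes x :: "'a ^ 'n::finite"
  shows "mpoly_eval c x (Poly_Mapping.single (Poly_Mapping.single i 1) 1) = x $ i"
proof -
  have "(\<Prod>j\<in>UNIV. x $ j ^ Poly_Mapping.lookup (Poly_Mapping.single i 1) j) =
      (\<Prod>j\<in>UNIV. if j = i then x $ j else 1)"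
    by (intro prod.cong) (auto simp: lookup_single when_def)
  then show ?thesis
    by (simp add: mpoly_eval_single hom_one)
qed

text \<open>Both factors are expanded into monomials, where multiplicativity amounts to adding
  exponents.\<close>

lemma mpoly_eval_mult:
  fixes x :: "'a ^ 'n::finite"
  shows "mpoly_eval c x (P * Q) = mpoly_eval c x P * mpoly_eval c x Q"
proof -
  let ?t = "\<lambda>P m. Poly_Mapping.single m (Poly_Mapping.lookup P m)"
  have expand: "P = (\<Sum>m\<in>Poly_Mapping.keys P. ?t P m)" for P :: "'n mpoly"
    by (intro poly_mapping_eqI)
      (auto simp: lookup_sum lookup_single when_def sum.delta in_keys_iff)
  have "P * Q = (\<Sum>m\<in>Poly_Mapping.keys P. \<Sum>n\<in>Poly_Mapping.keys Q. ?t P m * ?t Q n)"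
    by (subst (1) expand [of P], subst (1) expand [of Q]) (rule sum_product)
  then have "mpoly_eval c x (P * Q) =
      (\<Sum>m\<in>Poly_Mapping.keys P. \<Sum>n\<in>Poly_Mapping.keys Q.
        mpoly_eval c x (?t P m) * mpoly_eval c x (?t Q n))"
    by (simp add: mpoly_eval_sum mult_single mpoly_eval_single lookup_add hom_mult power_add
        prod.distrib mult_ac)
  also have "\<dots> = mpoly_eval c x P * mpoly_eval c x Q"
    unfolding mpoly_eval_single by (simp add: mpoly_eval_def sum_product)
  finally show ?thesis .
qed

end

interpretation real_id: real_algebra_hom "id :: real \<Rightarrow> real"
  by standard auto

interpretation ratfun_const: real_algebra_hom "ratfun_const :: real \<Rightarrow> 'n::{finite,linorder} ratfun"
  by standard (simp_all add: ratfun_const_def single_add mult_single flip: to_fract_mult)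

lemmas id_eval = real_id.mpoly_eval_add real_id.mpoly_eval_mult real_id.mpoly_eval_const
  real_id.mpoly_eval_one real_id.mpoly_eval_var
lemmas ratfun_eval = ratfun_const.mpoly_eval_add ratfun_const.mpoly_eval_mult
  ratfun_const.mpoly_eval_const ratfun_const.mpoly_eval_one ratfun_const.mpoly_eval_var

section \<open>Specialization as a partial ring homomorphism with unique values\<close>

lemma free_generating_setD:
  assumes "free_generating_set x" "mpoly_eval id p Q \<noteq> 0"
  shows "mpoly_eval ratfun_const x Q \<noteq> 0"
  using assms unfolding free_generating_set_def by (metis real_id.mpoly_eval_zero)

lemma specializes_const: "specializes x p (ratfun_const r) r"
  unfolding specializes_def
  by (intro exI [of _ "Poly_Mapping.single 0 r"] exI [of _ 1]) (simp add: id_eval ratfun_eval)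

lemma specializes_one: "specializes x p 1 1"
  using specializes_const [of x p 1] by (simp add: ratfun_const.hom_one)

lemma specializes_var: "specializes x p (x $ i) (p $ i)"
  unfolding specializes_def
  by (intro exI [of _ "Poly_Mapping.single (Poly_Mapping.single i 1) 1"] exI [of _ 1])
    (simp add: id_eval ratfun_eval flip: One_nat_def)

lemma specializes_mult:
  assumes "specializes x p f v" "specializes x p g w"
  shows "specializes x p (f * g) (v * w)"
proof -
  obtain P Q P' Q' where "mpoly_eval id p Q \<noteq> 0" "mpoly_eval id p Q' \<noteq> 0"
    "f = mpoly_eval ratfun_const x P / mpoly_eval ratfun_const x Q"
    "v = mpoly_eval id p P / mpoly_eval id p Q"
    "g = mpoly_eval ratfun_const x P' / mpoly_eval ratfun_const x Q'"
    "w = mpoly_eval id p P' / mpoly_eval id p Q'"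
    using assms unfolding specializes_def by blast
  then show ?thesis
    unfolding specializes_def
    by (intro exI [of _ "P * P'"] exI [of _ "Q * Q'"]) (simp add: id_eval ratfun_eval)
qed

text \<open>Freeness makes both denominators nonzero in the field, so that the fractions can be
  brought to a common denominator.\<close>

lemma specializes_add:
  assumes "free_generating_set x" "specializes x p f v" "specializes x p g w"
  shows "specializes x p (f + g) (v + w)"
proof -
  obtain P Q P' Q' where *: "mpoly_eval id p Q \<noteq> 0" "mpoly_eval id p Q' \<noteq> 0"
    "f = mpoly_eval ratfun_const x P / mpoly_eval ratfun_const x Q"
    "v = mpoly_eval id p P / mpoly_eval id p Q"
    "g = mpoly_eval ratfun_const x P' / mpoly_eval ratfun_const x Q'"
    "w = mpoly_eval id p P' / mpoly_eval id p Q'"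
    using assms unfolding specializes_def by blast
  with free_generating_setD [OF assms(1)] show ?thesis
    unfolding specializes_def
    by (intro exI [of _ "P * Q' + P' * Q"] exI [of _ "Q * Q'"])
      (simp add: id_eval ratfun_eval add_frac_eq)
qed

lemma specializes_inverse:
  assumes "specializes x p f v" "v \<noteq> 0"
  shows "specializes x p (inverse f) (inverse v)"
proof -
  obtain P Q where "mpoly_eval id p Q \<noteq> 0"
    "f = mpoly_eval ratfun_const x P / mpoly_eval ratfun_const x Q"
    "v = mpoly_eval id p P / mpoly_eval id p Q"
    using assms unfolding specializes_def by blast
  with assms(2) show ?thesis
    unfolding specializes_def
    by (intro exI [of _ Q] exI [of _ P]) (simp add: inverse_eq_divide)
qed

lemma specializes_divide:
  assumes "specializes x p f v" "specializes x p g w" "w \<noteq> 0"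
  shows "specializes x p (f / g) (v / w)"
  using assms by (simp add: divide_inverse specializes_mult specializes_inverse)

lemma specializes_power: "specializes x p f v \<Longrightarrow> specializes x p (f ^ n) (v ^ n)"
  by (induction n) (simp_all add: specializes_one specializes_mult)

lemma specializes_powi:
  assumes "specializes x p f v" "v \<noteq> 0"
  shows "specializes x p (f powi n) (v powi n)"
  using assms by (simp add: power_int_def specializes_power specializes_inverse)

lemma specializes_prod:
  assumes "\<And>i. i \<in> A \<Longrightarrow> specializes x p (f i) (v i)"
  shows "specializes x p (\<Prod>i\<in>A. f i) (\<Prod>i\<in>A. v i)"
  using assms
  by (induction A rule: infinite_finite_induct) (simp_all add: specializes_one specializes_mult)

lemma specializes_poly:
  assumes "free_generating_set x" "specializes x p f v"
  shows "specializes x p (poly (map_poly ratfun_const q) f) (poly q v)"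
proof (induction q)
  case 0
  show ?case
    using specializes_const [of x p 0] by (simp add: ratfun_const.hom_zero)
next
  case (pCons a q)
  then show ?case
    using assms
    by (simp add: map_poly_pCons ratfun_const.hom_zero specializes_add specializes_mult
        specializes_const)
qed

text \<open>By algebraic independence, two representations of \<open>f\<close> satisfy the
  cross-multiplied identity already as polynomials, and this identity can be evaluated at
  \<open>p\<close>.\<close>

lemma specializes_unique:
  assumes free: "free_generating_set x" and "specializes x p f v" "specializes x p f w"
  shows "v = w"
proof -
  obtain P Q P' Q' where *: "mpoly_eval id p Q \<noteq> 0" "mpoly_eval id p Q' \<noteq> 0"
    "f = mpoly_eval ratfun_const x P / mpoly_eval ratfun_const x Q"
    "v = mpoly_eval id p P / mpoly_eval id p Q"
    "f = mpoly_eval ratfun_const x P' / mpoly_eval ratfun_const x Q'"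
    "w = mpoly_eval id p P' / mpoly_eval id p Q'"
    using assms unfolding specializes_def by blast
  have "mpoly_eval ratfun_const x (P * Q') = mpoly_eval ratfun_const x (P' * Q)"
    using * free_generating_setD [OF free] by (simp add: ratfun_eval frac_eq_eq)
  \<comment> \<open>The difference is written with the constant polynomial -1, so that the
    evaluation rules for sums, products and constants suffice.\<close>
  moreover have "mpoly_eval ratfun_const x (P * Q' + Poly_Mapping.single 0 (-1) * (P' * Q)) =
      mpoly_eval ratfun_const x (P * Q') - mpoly_eval ratfun_const x (P' * Q)"
    using ratfun_const.hom_add [of 1 "-1", where 'n = 'a]
    by (simp add: ratfun_eval ratfun_const.hom_zero ratfun_const.hom_one add_eq_0_iff)
  ultimately have "P * Q' + Poly_Mapping.single 0 (-1) * (P' * Q) = 0"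
    using free unfolding free_generating_set_def by simp
  then have "mpoly_eval id p (P * Q' + Poly_Mapping.single 0 (-1) * (P' * Q)) = 0"
    by (simp add: real_id.mpoly_eval_zero)
  then show ?thesis
    using * by (simp add: id_eval frac_eq_eq)
qed


section \<open>Mutations with palindromic exchange polynomials\<close>

text \<open>The right-hand side of the exchange relation in \<open>cluster_mutation\<close>, with
  real numbers in place of cluster variables.\<close>

definition exchange_value :: "'n::finite \<Rightarrow> real ^ 'n \<Rightarrow> int ^ 'n ^ 'n \<Rightarrow> real poly \<Rightarrow> real" where
  "exchange_value k v B p =
     (\<Prod>i\<in>UNIV. v $ i powi pos_part (- B $ i $ k)) ^ degree p
       * poly p (\<Prod>i\<in>UNIV. v $ i powi (B $ i $ k)) / v $ k"

lemma specializes_cluster_mutation: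
  fixes x y :: "('n::{finite,linorder}) cluster" and v :: "real ^ ('n::{finite,linorder})"
  assumes "free_generating_set x" "\<And>i. specializes x p (y $ i) (v $ i)" "\<And>i. v $ i \<noteq> 0"
  shows "specializes x p (cluster_mutation k y B q $ j)
           (if j = k then exchange_value k v B q else v $ j)"
proof (cases "j = k")
  case True
  have "specializes x p
      ((\<Prod>i\<in>UNIV. y $ i powi pos_part (- B $ i $ k)) ^ degree q
         * poly (map_poly ratfun_const q) (\<Prod>i\<in>UNIV. y $ i powi (B $ i $ k)) / y $ k)
      (exchange_value k v B q)"
    unfolding exchange_value_def
    using assms
    by (intro specializes_divide specializes_mult specializes_power specializes_poly
        specializes_prod specializes_powi)
  with True show ?thesis
    by (simp add: cluster_mutation_def)
qed (simp add: cluster_mutation_def assms)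

text \<open>Let M be the product with exponents [-b]_+ and u the one with exponents b. Since [b]_+ =
  [-b]_+ + b, changing the sign of the matrix turns M^d q(u) into (M u)^d q(1/u), which is M^d times
  the reflected polynomial at u.\<close>

lemma exchange_value_minus:
  fixes v :: "real ^ 'n"
  assumes "reflect_poly q = q" "\<And>i. 0 < v $ i"
  shows "exchange_value k v (- B) q = exchange_value k v B q"
proof -
  let ?pr = "\<lambda>e. \<Prod>i\<in>UNIV. v $ i powi e (B $ i $ k)"
  have nz: "v $ i \<noteq> 0" for i
    using assms(2) [of i] by simp
  have "?pr (\<lambda>b. - b) = inverse (?pr (\<lambda>b. b))"
    by (simp add: power_int_minus flip: prod_inversef)
  moreover have "?pr pos_part = ?pr (\<lambda>b. pos_part (- b)) * ?pr (\<lambda>b. b)"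
    unfolding prod.distrib [symmetric]
    by (intro prod.cong refl) (auto simp: pos_part_def max_def nz power_int_minus)
  moreover have "?pr (\<lambda>b. b) \<noteq> 0"
    by (simp add: nz)
  ultimately have "?pr pos_part ^ degree q * poly q (?pr (\<lambda>b. - b)) =
      ?pr (\<lambda>b. pos_part (- b)) ^ degree q * poly (reflect_poly q) (?pr (\<lambda>b. b))"
    by (simp add: poly_reflect_poly_nz power_mult_distrib mult_ac)
  then show ?thesis
    using assms(1) by (simp add: exchange_value_def)
qed

text \<open>Substituting [b]_+ = b + [-b]_+ and [-c]_+ = [c]_+ - c, the two terms bc cancel; so the
  correction term of the mutation is odd in the matrix.\<close>

lemma matrix_mutation_minus: "matrix_mutation k d (- B) = - matrix_mutation k d B"
proof -
  have "pos_part (- b) * (- c) + (- b) * pos_part c = - (pos_part b * c + b * pos_part (- c))"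
    for b c :: int
    by (auto simp: pos_part_def max_def algebra_simps)
  then have "int d * (pos_part (- b) * (- c) + (- b) * pos_part c) =
      - (int d * (pos_part b * c + b * pos_part (- c)))" for b c :: int
    by (metis mult_minus_right)
  then show ?thesis
    by (auto simp: matrix_mutation_def vec_eq_iff)
qed


section \<open>Descent systems\<close>

text \<open>The rooted tree of triplets in abstract form: away from the root exactly one involution,
  \<open>m (down w)\<close>, lowers the height, and after an ascent in direction \<open>i\<close>
  the descent is again in direction \<open>i\<close>. At the root every direction ascends, hence the
  disjuncts \<open>w = r\<close>.\<close>

locale descent_system =
  fixes W :: "'w set" and r :: 'w and m :: "'n::finite \<Rightarrow> 'w \<Rightarrow> 'w"
    and down :: "'w \<Rightarrow> 'n" and height :: "'w \<Rightarrow> nat"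
  assumes root: "r \<in> W"
    and closed: "w \<in> W \<Longrightarrow> m i w \<in> W"
    and involution: "w \<in> W \<Longrightarrow> m i (m i w) = w"
    and descends: "w \<in> W \<Longrightarrow> w \<noteq> r \<Longrightarrow> height (m (down w) w) < height w"
    and ascends: "w \<in> W \<Longrightarrow> w = r \<or> i \<noteq> down w \<Longrightarrow> height w < height (m i w)"
    and down_ascent: "w \<in> W \<Longrightarrow> w = r \<or> i \<noteq> down w \<Longrightarrow> down (m i w) = i"
begin

lemma ascent_iff: "w \<in> W \<Longrightarrow> height w < height (m i w) \<longleftrightarrow> w = r \<or> i \<noteq> down w"
  using ascends descends by (metis less_asym)

text \<open>Applying the descending involution again climbs back to \<open>w\<close>, so it is an
  ascent from the lower element. This is the step for inductions on the height.\<close>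

lemma parent:
  assumes "w \<in> W" "w \<noteq> r"
  obtains u where "u \<in> W" "height u < height w" "u = r \<or> down w \<noteq> down u" "w = m (down w) u"
proof
  let ?u = "m (down w) w"
  show "?u \<in> W" "height ?u < height w" "w = m (down w) ?u"
    using assms closed descends involution by simp_all
  then show "?u = r \<or> down w \<noteq> down ?u"
    using ascent_iff [of ?u "down w"] by simp
qed

lemma reachable_eq:
  assumes child: "\<And>v w. v \<in> W \<Longrightarrow> child v w \<longleftrightarrow> (\<exists>i. (v = r \<or> i \<noteq> down v) \<and> w = m i v)"
  shows "{w. child\<^sup>*\<^sup>* r w} = W"
proof safe
  fix w assume "child\<^sup>*\<^sup>* r w"
  then show "w \<in> W"
    by induction (use root closed child in auto)
next
  fix w assume "w \<in> W"
  then show "child\<^sup>*\<^sup>* r w"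
  proof (induction "height w" arbitrary: w rule: less_induct)
    case less
    show ?case
    proof (cases "w = r")
      case False
      with less.prems obtain u where u: "u \<in> W" "height u < height w"
          "u = r \<or> down w \<noteq> down u" "w = m (down w) u"
        by (rule parent)
      then have "child u w"
        using child by blast
      with less.hyps u show ?thesis
        by (meson rtranclp.rtrancl_into_rtrancl)
    qed simp
  qed
qed

text \<open>A move by \<open>m i\<close> is either an ascent from \<open>v\<close> or, as
  \<open>m i\<close> is an involution, the reverse of an ascent from \<open>w\<close>.\<close>

lemma adjacent_iff:
  assumes child: "\<And>v w. v \<in> W \<Longrightarrow> child v w \<longleftrightarrow> (\<exists>i. (v = r \<or> i \<noteq> down v) \<and> w = m i v)"
    and "v \<in> W" "w \<in> W"
  shows "child v w \<or> child w v \<longleftrightarrow> (\<exists>i. w = m i v)"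
proof
  assume "child v w \<or> child w v"
  then show "\<exists>i. w = m i v"
    unfolding child [OF assms(2)] child [OF assms(3)] using involution [OF assms(3)] by metis
next
  assume "\<exists>i. w = m i v"
  then obtain i where w: "w = m i v" ..
  show "child v w \<or> child w v"
  proof (cases "v = r \<or> i \<noteq> down v")
    case True
    with w show ?thesis
      using child [OF assms(2)] by blast
  next
    case False
    then have "height w < height v"
      using w assms(2) descends by blast
    moreover have v: "v = m i w"
      using w assms(2) involution by simp
    ultimately have "w = r \<or> i \<noteq> down w"
      using ascent_iff [OF assms(3), of i] by simp
    with v show ?thesis
      using child [OF assms(3)] by blast
  qed
qed

text \<open>
  A connected regular graph that carries the action is a covering of \<open>W\<close>, and the covering has
  one sheet: along a path without backtracking from \<open>t0\<close> the height increases strictly, so that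
  \<open>t0\<close> is the only vertex over \<open>r\<close>.
\<close>

lemma covering_graph_iso:
  fixes V :: "'v set" and lab :: "'v \<Rightarrow> 'v \<Rightarrow> 'n"
  assumes tree: "labeled_regular_tree V R lab" and t0: "t0 \<in> V" "\<phi> t0 = r"
    and V: "\<And>t. t \<in> V \<Longrightarrow> \<phi> t \<in> W"
    and step: "\<And>t t'. (t, t') \<in> R \<Longrightarrow> \<phi> t' = m (lab t t') (\<phi> t)"
    and Q: "\<And>v w. v \<in> W \<Longrightarrow> w \<in> W \<Longrightarrow> (v, w) \<in> Q \<longleftrightarrow> (\<exists>i. w = m i v)"
  shows "graph_iso V R W Q \<phi>"
proof -
  have R: "R \<subseteq> V \<times> V" "sym R" and conn: "\<And>u v. u \<in> V \<Longrightarrow> v \<in> V \<Longrightarrow> (u, v) \<in> R\<^sup>*"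
    using tree unfolding labeled_regular_tree_def is_tree_def by auto
  have lab_sym: "lab u v = lab v u" if "(u, v) \<in> R" for u v
    using tree that unfolding labeled_regular_tree_def by blast
  have lab_bij: "bij_betw (lab v) {w. (v, w) \<in> R} UNIV" if "v \<in> V" for v
  proof -
    have "card {w. (v, w) \<in> R} = CARD('n)" "inj_on (lab v) {w. (v, w) \<in> R}"
      using tree that unfolding labeled_regular_tree_def by auto
    then show ?thesis
      by (simp add: bij_betw_def card_image card_eq_UNIV_imp_eq_UNIV)
  qed
  have nb: "\<exists>w. (v, w) \<in> R \<and> lab v w = i" if "v \<in> V" for v i
  proof -
    have "i \<in> lab v ` {w. (v, w) \<in> R}"
      using lab_bij [OF that] by (simp add: bij_betw_def)
    then show ?thesis by auto
  qed
  have nb_unique: "w = w'" if "(v, w) \<in> R" "(v, w') \<in> R" "lab v w = lab v w'" for v w w'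
  proof (rule inj_onD [OF bij_betw_imp_inj_on [OF lab_bij]])
    show "v \<in> V"
      using that(1) R(1) by blast
  qed (use that in auto)

  \<comment> \<open>The vertices that can be reached from \<open>t0\<close> by a path along which
    the height increases at every edge.\<close>
  define A where "A = {t. (t0, t) \<in> {(t, t'). (t, t') \<in> R \<and> height (\<phi> t) < height (\<phi> t')}\<^sup>*}"
  have A_V: "t \<in> V" if "t \<in> A" for t
    using that unfolding A_def mem_Collect_eq by induction (use t0 R in auto)
  have A_step: "t' \<in> A" if "t \<in> A" "(t, t') \<in> R" for t t'
  proof (cases "height (\<phi> t) < height (\<phi> t')")
    case True
    with that show ?thesis
      unfolding A_def by (auto intro: rtrancl_into_rtrancl)
  next
    case False
    then have neq: "\<phi> t \<noteq> r" and lab: "lab t t' = down (\<phi> t)"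
      using ascends [of "\<phi> t" "lab t t'"] step [OF that(2)] V A_V [OF that(1)] by auto
    have "(t0, t) \<in> {(t, t'). (t, t') \<in> R \<and> height (\<phi> t) < height (\<phi> t')}\<^sup>*"
      using that(1) by (simp add: A_def)
    then show ?thesis
    proof cases
      case base
      with neq t0 show ?thesis by simp
    next
      case (step s)
      then have s: "s \<in> A" "(s, t) \<in> R" "height (\<phi> s) < height (\<phi> t)"
        by (auto simp: A_def)
      have "\<phi> t = m (lab s t) (\<phi> s)"
        using assms(5) s(2) .
      \<comment> \<open>The last edge of the increasing path to \<open>t\<close> is labelled by the
        descent direction of its end, as is the edge from \<open>t\<close> to \<open>t'\<close>.
        Labels at a vertex are distinct, so \<open>t'\<close> is the predecessor \<open>s\<close>,
        which lies in \<open>A\<close>.\<close>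
      then have "down (\<phi> t) = lab s t"
        using s V A_V ascent_iff down_ascent by metis
      then have "s = t'"
        using nb_unique [of t s t'] lab lab_sym s(2) that(2) R(2) by (metis symD)
      with s show ?thesis by simp
    qed
  qed
  \<comment> \<open>By connectedness \<open>A\<close> is all of \<open>V\<close>. An increasing path
    that is not trivial ends above \<open>height r\<close>, so only \<open>t0\<close> lies over the
    root.\<close>
  have "t \<in> A" if "t \<in> V" for t
    using conn [OF t0(1) that] by induction (use A_step in \<open>auto simp: A_def\<close>)
  then have root_unique: "t = t0" if "t \<in> V" "\<phi> t = r" for t
  proof -
    have "t = t0 \<or> height r < height (\<phi> t)"
      if "(t0, t) \<in> {(t, t'). (t, t') \<in> R \<and> height (\<phi> t) < height (\<phi> t')}\<^sup>*" for t
      using that by induction (use t0 in auto)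
    with that \<open>\<And>t. t \<in> V \<Longrightarrow> t \<in> A\<close> show ?thesis
      unfolding A_def by fastforce
  qed

  \<comment> \<open>Induction on the height: the parent of \<open>w\<close> has a single preimage
    \<open>s\<close>, and the neighbour of \<open>s\<close> along the label \<open>down w\<close> is
    the only vertex over \<open>w\<close>, because following that label back from any preimage of
    \<open>w\<close> leads to \<open>s\<close>.\<close>
  have fibre: "\<exists>!t. t \<in> V \<and> \<phi> t = w" if "w \<in> W" for w
    using that
  proof (induction "height w" arbitrary: w rule: less_induct)
    case less
    show ?case
    proof (cases "w = r")
      case True
      with t0 root_unique show ?thesis by blast
    next
      case False
      let ?i = "down w"
      have u: "m ?i w \<in> W" "height (m ?i w) < height w" "m ?i (m ?i w) = w"
        using less.prems False closed descends involution by auto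
      obtain s where s: "s \<in> V" "\<phi> s = m ?i w"
        and s_unique: "\<And>s'. s' \<in> V \<Longrightarrow> \<phi> s' = m ?i w \<Longrightarrow> s' = s"
        using less.hyps [OF u(2,1)] by blast
      obtain t where t: "(s, t) \<in> R" "lab s t = ?i"
        using nb [OF s(1)] by blast
      have "t' = t" if t': "t' \<in> V" "\<phi> t' = w" for t'
      proof -
        obtain s' where s': "(t', s') \<in> R" "lab t' s' = ?i"
          using nb [OF t'(1)] by blast
        then have "s' = s"
          using step [OF s'(1)] t' R(1) by (intro s_unique) auto
        with s' have "(s, t') \<in> R" "lab s t' = ?i"
          using R(2) lab_sym by (auto dest: symD)
        with t show "t' = t"
          using nb_unique by metis
      qed
      moreover have "t \<in> V" "\<phi> t = w"
        using t s u R(1) step [OF t(1)] by auto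
      ultimately show ?thesis by blast
    qed
  qed
  have "bij_betw \<phi> V W"
    unfolding bij_betw_def
  proof
    show "inj_on \<phi> V"
      using fibre V by (metis inj_onI)
    show "\<phi> ` V = W"
      using fibre V by blast
  qed
  moreover have "(u, v) \<in> R \<longleftrightarrow> (\<phi> u, \<phi> v) \<in> Q" if "u \<in> V" "v \<in> V" for u v
  proof
    assume "(u, v) \<in> R"
    then show "(\<phi> u, \<phi> v) \<in> Q"
      using step Q V that by blast
  next
    assume "(\<phi> u, \<phi> v) \<in> Q"
    then obtain i where i: "\<phi> v = m i (\<phi> u)"
      using Q [OF V [OF \<open>u \<in> V\<close>] V [OF \<open>v \<in> V\<close>]] by blast
    obtain v' where v': "(u, v') \<in> R" "lab u v' = i"
      using nb \<open>u \<in> V\<close> by blast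
    then have "\<phi> v' = \<phi> v" "v' \<in> V"
      using step i R(1) by auto
    then have "v' = v"
      using fibre V \<open>v \<in> V\<close> by metis
    with v' show "(u, v) \<in> R" by simp
  qed
  ultimately show ?thesis
    unfolding graph_iso_def by blast
qed

end

text \<open>An injective equivariant map reflects both the involution law and the root; the
  conditions on height and direction are inherited through it. It is applied to the squaring of
  entries.\<close>

lemma descent_system_pullback:
  assumes "descent_system W r m down height"
    and s: "\<And>v. v \<in> W' \<Longrightarrow> s v \<in> W" "inj_on s W'" "r' \<in> W'" "s r' = r"
    and m': "\<And>v i. v \<in> W' \<Longrightarrow> m' i v \<in> W'" "\<And>v i. v \<in> W' \<Longrightarrow> s (m' i v) = m i (s v)"
  shows "descent_system W' r' m' (down \<circ> s) (height \<circ> s)"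
proof -
  interpret descent_system W r m down height by fact
  have root_iff: "s v = r \<longleftrightarrow> v = r'" if "v \<in> W'" for v
    using that s by (metis inj_onD)
  show ?thesis
  proof
    fix v i assume v: "v \<in> W'"
    have "s (m' i (m' i v)) = s v"
      using v s m' involution by simp
    then show "m' i (m' i v) = v"
      using v s(2) m'(1) by (meson inj_onD)
  qed (use s m' root_iff descends ascends down_ascent in auto)
qed


section \<open>Generalized Markov equations\<close>

definition markov :: "nat \<Rightarrow> nat \<Rightarrow> nat \<Rightarrow> real \<Rightarrow> real \<Rightarrow> real \<Rightarrow> bool" where
  "markov k1 k2 k3 a b c \<longleftrightarrow>
     a\<^sup>2 + b\<^sup>2 + c\<^sup>2 + real k1 * a * b + real k2 * b * c + real k3 * c * a
       = (3 + real k1 + real k2 + real k3) * a * b * c"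

text \<open>The equation is cyclically symmetric if the coefficients rotate along, so only exchanges
  at the first entry need to be analysed.\<close>

lemma markov_rotate: "markov k1 k2 k3 a b c \<longleftrightarrow> markov k2 k3 k1 b c a"
  by (simp add: markov_def algebra_simps)

text \<open>Two forms of the other root of the equation in its first variable: product of the roots
  divided by \<open>a\<close>, and sum of the roots minus \<open>a\<close>. The first is the
  exchange relation, the second is visibly integral.\<close>

lemma vieta_partner:
  assumes "markov k1 k2 k3 a b c" "a \<noteq> 0"
  shows "(b\<^sup>2 + real k2 * b * c + c\<^sup>2) / a =
    (3 + real k1 + real k2 + real k3) * b * c - real k1 * b - real k3 * c - a"
  using assms by (simp add: markov_def field_simps power2_eq_square)

lemma markov_vieta:
  assumes "markov k1 k2 k3 a b c" "a \<noteq> 0"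
  shows "markov k1 k2 k3 ((b\<^sup>2 + real k2 * b * c + c\<^sup>2) / a) b c"
  unfolding vieta_partner [OF assms] using assms(1)
  unfolding markov_def by algebra

lemma Ints_ge_1: "(x::real) \<in> \<int> \<Longrightarrow> 0 < x \<Longrightarrow> 1 \<le> x"
  by (auto elim!: Ints_cases)

text \<open>
  The Markov polynomial, quadratic in its first argument with roots \<open>a\<close> and \<open>a'\<close>, is negative at
  the maximum of the two other arguments, unless this is \<open>1\<close>.
\<close>

lemma vieta_product_negative:
  fixes a b c :: real
  assumes eq: "markov k1 k2 k3 a b c" and "a \<noteq> 0" "1 \<le> b" "1 \<le> c"
    and N: "N = b \<and> c \<le> b \<or> N = c \<and> b \<le> c" and "1 < N"
  shows "(a - N) * ((b\<^sup>2 + real k2 * b * c + c\<^sup>2) / a - N) < 0"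
proof -
  have prod: "a * ((b\<^sup>2 + real k2 * b * c + c\<^sup>2) / a) = b\<^sup>2 + real k2 * b * c + c\<^sup>2"
    using assms by simp
  have "(a - N) * (p - N) = a * p - N * (a + p) + N\<^sup>2" for p
    by (simp add: algebra_simps power2_eq_square)
  then have "(a - N) * ((b\<^sup>2 + real k2 * b * c + c\<^sup>2) / a - N) =
      a * ((b\<^sup>2 + real k2 * b * c + c\<^sup>2) / a)
        - N * (a + (b\<^sup>2 + real k2 * b * c + c\<^sup>2) / a) + N\<^sup>2" .
  also have "\<dots> = b\<^sup>2 + real k2 * b * c + c\<^sup>2 + N\<^sup>2
      - N * ((3 + real k1 + real k2 + real k3) * b * c - real k1 * b - real k3 * c)"
    unfolding prod unfolding vieta_partner [OF eq \<open>a \<noteq> 0\<close>] by (simp add: algebra_simps)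
  \<comment> \<open>The coefficients contribute only nonnegative terms with a minus sign, so the
    classical Markov equation is the extreme case.\<close>
  also have "\<dots> = (b\<^sup>2 + c\<^sup>2 + N\<^sup>2 - 3 * (N * b * c)) - real k1 * (N * b) * (c - 1)
      - real k2 * (b * c) * (N - 1) - real k3 * (N * c) * (b - 1)"
    by (simp add: algebra_simps power2_eq_square)
  also have "\<dots> \<le> b\<^sup>2 + c\<^sup>2 + N\<^sup>2 - 3 * (N * b * c)"
  proof -
    have "0 \<le> real k1 * (N * b) * (c - 1)" "0 \<le> real k2 * (b * c) * (N - 1)"
      "0 \<le> real k3 * (N * c) * (b - 1)"
      using assms by simp_all
    then show ?thesis by linarith
  qed
  also have "\<dots> < 0"
  proof -
    \<comment> \<open>Here \<open>y\<close> is the larger and \<open>z\<close> the smaller of the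
      two entries, and \<open>y\<close> is also \<open>N\<close>.\<close>
    have *: "2 * y\<^sup>2 + z\<^sup>2 < 3 * (y * y * z)" if "1 \<le> z" "z \<le> y" "1 < y" for y z :: real
    proof -
      have "z * z \<le> y * z" "y * z < y * y * z"
        using that by simp_all
      moreover have "2 * y\<^sup>2 \<le> 2 * (y * y * z)"
        using that by (simp add: power2_eq_square)
      ultimately show ?thesis
        by (simp add: power2_eq_square)
    qed
    show ?thesis
      using N *[of c b] *[of b c] assms by (auto simp: mult_ac)
  qed
  finally show ?thesis .
qed

text \<open>The maximum of \<open>b\<close> and \<open>c\<close> lies strictly between the two
  roots, so exactly one root exceeds both entries; the case \<open>b = c = 1\<close> is checked by
  hand.\<close>

lemma vieta_separation:
  assumes eq: "markov k1 k2 k3 a b c" and "0 < a" "1 \<le> b" "1 \<le> c"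
    and a': "a' = (b\<^sup>2 + real k2 * b * c + c\<^sup>2) / a"
  shows "(a \<le> b \<or> a \<le> c) \<and> b < a' \<and> c < a' \<or> b < a \<and> c < a \<and> (a' \<le> b \<or> a' \<le> c)"
proof (cases "b = 1 \<and> c = 1")
  case True
  \<comment> \<open>The maximum is 1, so the sign argument fails, but the roots are explicitly 1 and
    2 + k2.\<close>
  then have "(a - 1) * (a - (2 + real k2)) = 0"
    using eq by (simp add: markov_def algebra_simps power2_eq_square)
  then have "a = 1 \<or> a = 2 + real k2"
    by simp
  with True a' show ?thesis by auto
next
  case False
  define N where "N = max b c"
  have "(a - N) * (a' - N) < 0"
    unfolding a'
    by (rule vieta_product_negative [OF eq]) (use assms False in \<open>auto simp: N_def max_def\<close>)
  then have "a < N \<and> N < a' \<or> N < a \<and> a' < N"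
    by (auto simp: mult_less_0_iff)
  then show ?thesis
    by (auto simp: N_def)
qed

text \<open>If \<open>a\<close> equals the maximum \<open>N\<close> of the others, the product of
  \<open>vieta_product_negative\<close> is zero instead of negative. This excludes ties for the
  largest entry.\<close>

lemma vieta_separation_strict:
  assumes eq: "markov k1 k2 k3 a b c" and "0 < a" "1 \<le> b" "1 \<le> c"
    and "a = b \<and> c \<le> b \<or> a = c \<and> b \<le> c"
  shows "a = 1 \<and> b = 1 \<and> c = 1"
proof (rule ccontr)
  assume "\<not> ?thesis"
  then have "(a - a) * ((b\<^sup>2 + real k2 * b * c + c\<^sup>2) / a - a) < 0"
    by (intro vieta_product_negative [OF eq]) (use assms in auto)
  then show False by simp
qed

section \<open>Exchanges on generalized Markov triples as a descent system\<close>

definition markov_triplets :: "nat \<Rightarrow> nat \<Rightarrow> nat \<Rightarrow> triplet set" where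
  "markov_triplets k1 k2 k3 =
     {(a, b, c). a \<in> \<int> \<and> b \<in> \<int> \<and> c \<in> \<int> \<and> 0 < a \<and> 0 < b \<and> 0 < c \<and> markov k1 k2 k3 a b c}"

definition markov_exchange :: "nat \<Rightarrow> nat \<Rightarrow> nat \<Rightarrow> 3 \<Rightarrow> triplet \<Rightarrow> triplet" where
  "markov_exchange k1 k2 k3 i v = (case v of (a, b, c) \<Rightarrow>
     if i = 1 then ((b\<^sup>2 + real k2 * b * c + c\<^sup>2) / a, b, c)
     else if i = 2 then (a, (a\<^sup>2 + real k3 * a * c + c\<^sup>2) / b, c)
     else (a, b, (a\<^sup>2 + real k1 * a * b + b\<^sup>2) / c))"

text \<open>The last branch also serves as a default for ties, which among solutions occur only at
  (1, 1, 1).\<close>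

definition max_index :: "triplet \<Rightarrow> 3" where
  "max_index v = (case v of (a, b, c) \<Rightarrow>
     if b < a \<and> c < a then 1 else if a < b \<and> c < b then 2 else 3)"

definition entry_sum :: "triplet \<Rightarrow> nat" where
  "entry_sum v = (case v of (a, b, c) \<Rightarrow> nat \<lfloor>a + b + c\<rfloor>)"

lemma entry_sum_less:
  assumes "a \<in> \<int>" "b \<in> \<int>" "c \<in> \<int>" "a' \<in> \<int>" "b' \<in> \<int>" "c' \<in> \<int>"
    "0 \<le> a + b + c" "a + b + c < a' + b' + c'"
  shows "entry_sum (a, b, c) < entry_sum (a', b', c')"
proof -
  obtain m n where mn: "a + b + c = of_int m" "a' + b' + c' = of_int n"
    using assms by (metis Ints_add Ints_cases)
  with assms(7,8) have "0 \<le> m" "m < n"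
    by simp_all
  then show ?thesis
    unfolding entry_sum_def prod.case mn by simp
qed

lemma markov_triplets_rotate:
  "(a, b, c) \<in> markov_triplets k1 k2 k3 \<longleftrightarrow> (b, c, a) \<in> markov_triplets k2 k3 k1"
  using markov_rotate [of k1 k2 k3 a b c] by (auto simp: markov_triplets_def)

text \<open>Positivity is read off the quotient form of the new entry, integrality off the form
  given by the sum of the roots.\<close>

lemma markov_triplets_vieta:
  assumes "(a, b, c) \<in> markov_triplets k1 k2 k3"
  shows "((b\<^sup>2 + real k2 * b * c + c\<^sup>2) / a, b, c) \<in> markov_triplets k1 k2 k3"
proof -
  have a: "a \<noteq> 0" and eq: "markov k1 k2 k3 a b c"
    using assms by (auto simp: markov_triplets_def)
  have "0 < (b\<^sup>2 + real k2 * b * c + c\<^sup>2) / a"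
    using assms by (auto simp: markov_triplets_def intro!: divide_pos_pos add_pos_nonneg add_nonneg_pos)
  moreover have "(b\<^sup>2 + real k2 * b * c + c\<^sup>2) / a \<in> \<int>"
    unfolding vieta_partner [OF eq a] using assms by (auto simp: markov_triplets_def)
  ultimately show ?thesis
    using markov_vieta [OF eq a] assms by (auto simp: markov_triplets_def)
qed

lemma markov_exchange_closed:
  assumes "v \<in> markov_triplets k1 k2 k3"
  shows "markov_exchange k1 k2 k3 i v \<in> markov_triplets k1 k2 k3"
proof -
  obtain a b c where v: "v = (a, b, c)"
    by (cases v)
  have "(b, c, a) \<in> markov_triplets k2 k3 k1" "(c, a, b) \<in> markov_triplets k3 k1 k2"
    using assms markov_triplets_rotate unfolding v by metis+
  from this [THEN markov_triplets_vieta]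
  have "(a, (a\<^sup>2 + real k3 * a * c + c\<^sup>2) / b, c) \<in> markov_triplets k1 k2 k3"
    "(a, b, (a\<^sup>2 + real k1 * a * b + b\<^sup>2) / c) \<in> markov_triplets k1 k2 k3"
    unfolding markov_triplets_rotate [of a _ _ k1]
    unfolding markov_triplets_rotate [of b _ _ k2] by (simp_all add: ac_simps)
  then show ?thesis
    using markov_triplets_vieta assms unfolding v by (simp add: markov_exchange_def)
qed

text \<open>The three rotations of \<open>vieta_separation\<close>: an exchange either creates a
  strictly largest entry or replaces a strictly largest entry by one that is not.\<close>

lemma markov_exchange_separation:
  assumes "(a, b, c) \<in> markov_triplets k1 k2 k3"
  shows "a' = (b\<^sup>2 + real k2 * b * c + c\<^sup>2) / a \<Longrightarrow>
      (a \<le> b \<or> a \<le> c) \<and> b < a' \<and> c < a' \<or> b < a \<and> c < a \<and> (a' \<le> b \<or> a' \<le> c)"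
    and "b' = (a\<^sup>2 + real k3 * a * c + c\<^sup>2) / b \<Longrightarrow>
      (b \<le> a \<or> b \<le> c) \<and> a < b' \<and> c < b' \<or> a < b \<and> c < b \<and> (b' \<le> a \<or> b' \<le> c)"
    and "c' = (a\<^sup>2 + real k1 * a * b + b\<^sup>2) / c \<Longrightarrow>
      (c \<le> a \<or> c \<le> b) \<and> a < c' \<and> b < c' \<or> a < c \<and> b < c \<and> (c' \<le> a \<or> c' \<le> b)"
proof -
  have *: "1 \<le> a" "1 \<le> b" "1 \<le> c" "markov k1 k2 k3 a b c"
    using assms by (auto simp: markov_triplets_def Ints_ge_1)
  then have "markov k2 k3 k1 b c a" "markov k3 k1 k2 c a b"
    by (metis markov_rotate)+
  note eqs = * this
  show "a' = (b\<^sup>2 + real k2 * b * c + c\<^sup>2) / a \<Longrightarrow>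
      (a \<le> b \<or> a \<le> c) \<and> b < a' \<and> c < a' \<or> b < a \<and> c < a \<and> (a' \<le> b \<or> a' \<le> c)"
    using vieta_separation [OF eqs(4)] eqs by auto
  show "b' = (a\<^sup>2 + real k3 * a * c + c\<^sup>2) / b \<Longrightarrow>
      (b \<le> a \<or> b \<le> c) \<and> a < b' \<and> c < b' \<or> a < b \<and> c < b \<and> (b' \<le> a \<or> b' \<le> c)"
    using vieta_separation [OF eqs(5)] eqs(1-3) by (auto simp: ac_simps)
  show "c' = (a\<^sup>2 + real k1 * a * b + b\<^sup>2) / c \<Longrightarrow>
      (c \<le> a \<or> c \<le> b) \<and> a < c' \<and> b < c' \<or> a < c \<and> b < c \<and> (c' \<le> a \<or> c' \<le> b)"
    using vieta_separation [OF eqs(6)] eqs(1-3) by (auto simp: ac_simps)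
qed

lemma markov_strict_max:
  assumes "(a, b, c) \<in> markov_triplets k1 k2 k3" "(a, b, c) \<noteq> (1, 1, 1)"
  shows "b < a \<and> c < a \<or> a < b \<and> c < b \<or> a < c \<and> b < c"
proof (rule ccontr)
  assume "\<not> ?thesis"
  \<comment> \<open>The first alternative covers ties of \<open>a\<close> with another entry, the
    second those of \<open>b\<close>; together they include all three pairs.\<close>
  then consider "a = b \<and> c \<le> b \<or> a = c \<and> b \<le> c" | "b = c \<and> a \<le> c \<or> b = a \<and> c \<le> a"
    by linarith
  moreover have *: "1 \<le> a" "1 \<le> b" "1 \<le> c" "markov k1 k2 k3 a b c"
    using assms by (auto simp: markov_triplets_def Ints_ge_1)
  moreover from *(4) have "markov k2 k3 k1 b c a"
    by (metis markov_rotate)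
  ultimately have "a = 1 \<and> b = 1 \<and> c = 1"
    using vieta_separation_strict [of k1 k2 k3 a b c] vieta_separation_strict [of k2 k3 k1 b c a]
    by cases simp_all
  with assms(2) show False by simp
qed

lemma markov_descent:
  "descent_system (markov_triplets k1 k2 k3) (1, 1, 1) (markov_exchange k1 k2 k3) max_index entry_sum"
proof
  show "(1, 1, 1) \<in> markov_triplets k1 k2 k3"
    by (simp add: markov_triplets_def markov_def)
next
  fix w :: triplet and i :: 3
  assume w: "w \<in> markov_triplets k1 k2 k3"
  obtain a b c where abc: "w = (a, b, c)"
    by (cases w)
  let ?w' = "markov_exchange k1 k2 k3 i w"
  obtain a' b' c' where abc': "?w' = (a', b', c')"
    by (cases ?w')
  have pos: "0 < a" "0 < b" "0 < c" and Ints: "a \<in> \<int>" "b \<in> \<int>" "c \<in> \<int>"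
    using w unfolding abc by (auto simp: markov_triplets_def)
  show w': "?w' \<in> markov_triplets k1 k2 k3"
    using w by (rule markov_exchange_closed)
  then have pos': "0 < a'" "0 < b'" "0 < c'" and Ints': "a' \<in> \<int>" "b' \<in> \<int>" "c' \<in> \<int>"
    unfolding abc' by (auto simp: markov_triplets_def)
  \<comment> \<open>The numerator of an exchange does not contain the exchanged entry; being
    nonzero, it gives the old entry back when divided by the new one.\<close>
  have nz: "b\<^sup>2 + real k2 * b * c + c\<^sup>2 > 0" "a\<^sup>2 + real k3 * a * c + c\<^sup>2 > 0"
    "a\<^sup>2 + real k1 * a * b + b\<^sup>2 > 0"
    using pos by (auto intro!: add_pos_nonneg add_nonneg_pos)
  show "markov_exchange k1 k2 k3 i ?w' = w"
    using nz unfolding abc by (auto simp: markov_exchange_def)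
  note sep = markov_exchange_separation [OF w [unfolded abc]]
  note i_cases = exhaust_3 [of i]
  note sum_less = entry_sum_less [OF Ints Ints'] entry_sum_less [OF Ints' Ints]
  {
    \<comment> \<open>Entry \<open>i\<close> is not strictly largest here, so the separation lemma
      leaves only its first alternative: the new entry is larger than the old one and than both
      others.\<close>
    assume i: "w = (1, 1, 1) \<or> i \<noteq> max_index w"
    show "entry_sum w < entry_sum ?w'"
      using i_cases
    proof (elim disjE)
      assume "i = 1"
      with sep(1) [of a'] i abc' abc sum_less pos show ?thesis
        by (auto simp: markov_exchange_def max_index_def)
    next
      assume "i = 2"
      with sep(2) [of b'] i abc' abc sum_less pos show ?thesis
        by (auto simp: markov_exchange_def max_index_def)
    next
      assume "i = 3"
      with sep(3) [of c'] i abc' abc sum_less pos show ?thesis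
        by (auto simp: markov_exchange_def max_index_def split: if_splits)
    qed
    show "max_index ?w' = i"
      using i_cases
    proof (elim disjE)
      assume "i = 1"
      with sep(1) [of a'] i abc' abc show ?thesis
        by (auto simp: markov_exchange_def max_index_def)
    next
      assume "i = 2"
      with sep(2) [of b'] i abc' abc show ?thesis
        by (auto simp: markov_exchange_def max_index_def)
    next
      assume "i = 3"
      with sep(3) [of c'] i abc' abc show ?thesis
        by (auto simp: markov_exchange_def max_index_def split: if_splits)
    qed
  }
next
  fix w :: triplet
  assume w: "w \<in> markov_triplets k1 k2 k3" "w \<noteq> (1, 1, 1)"
  obtain a b c where abc: "w = (a, b, c)"
    by (cases w)
  let ?w' = "markov_exchange k1 k2 k3 (max_index w) w"
  obtain a' b' c' where abc': "?w' = (a', b', c')"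
    by (cases ?w')
  have Ints: "a \<in> \<int>" "b \<in> \<int>" "c \<in> \<int>"
    using w unfolding abc by (auto simp: markov_triplets_def)
  have "?w' \<in> markov_triplets k1 k2 k3"
    using w(1) by (rule markov_exchange_closed)
  then have pos': "0 < a'" "0 < b'" "0 < c'" and Ints': "a' \<in> \<int>" "b' \<in> \<int>" "c' \<in> \<int>"
    unfolding abc' by (auto simp: markov_triplets_def)
  note sep = markov_exchange_separation [OF w(1) [unfolded abc]]
  note sum_less = entry_sum_less [OF Ints' Ints]
  \<comment> \<open>The exchanged entry is strictly largest, so the second alternative of the
    separation lemma applies and the sum drops.\<close>
  from markov_strict_max [OF w [unfolded abc]]
  have "a' + b' + c' < a + b + c"
  proof (elim disjE)
    assume "b < a \<and> c < a"
    with sep(1) [of a'] abc' abc show ?thesis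
      by (auto simp: markov_exchange_def max_index_def)
  next
    assume "a < b \<and> c < b"
    with sep(2) [of b'] abc' abc show ?thesis
      by (auto simp: markov_exchange_def max_index_def)
  next
    assume "a < c \<and> b < c"
    with sep(3) [of c'] abc' abc show ?thesis
      by (auto simp: markov_exchange_def max_index_def)
  qed
  with pos' have "entry_sum (a', b', c') < entry_sum (a, b, c)"
    by (intro entry_sum_less Ints Ints') auto
  then show "entry_sum ?w' < entry_sum w"
    by (simp only: abc' flip: abc)
qed

text \<open>The rules of the tree ask only for a maximal entry. Away from the root it is strictly
  maximal, so just the two rules for that entry apply, and they are the exchanges at the two other
  entries.\<close>

lemma triplet_child_iff:
  assumes "v \<in> markov_triplets k1 k2 k3"
  shows "triplet_child k1 k2 k3 v w \<longleftrightarrow>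
    (\<exists>i. (v = (1, 1, 1) \<or> i \<noteq> max_index v) \<and> w = markov_exchange k1 k2 k3 i v)"
proof -
  obtain a b c where abc: "v = (a, b, c)"
    by (cases v)
  have ex3: "(\<exists>i::3. P i) \<longleftrightarrow> P 1 \<or> P 2 \<or> P 3" for P
    by (metis exhaust_3)
  show ?thesis
  proof (cases "v = (1, 1, 1)")
    case True
    then show ?thesis
      by (auto simp: ex3 markov_exchange_def triplet_child.simps)
  next
    case False
    then consider "b < a" "c < a" | "a < b" "c < b" | "a < c" "b < c"
      using markov_strict_max [of a b c] assms abc by blast
    then show ?thesis
      using False unfolding ex3 abc
      by cases (auto simp: triplet_child.simps markov_exchange_def max_index_def max_def)
  qed
qed

section \<open>Reduction of the equations with fourth powers by squaring\<close>

text \<open>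
  A solution of the equation of the fifth and sixth datum becomes a generalized Markov triple with
  \<open>k1 = k3 = 2\<close> when its second and third entries are squared.
\<close>

definition square_tail :: "triplet \<Rightarrow> triplet" where
  "square_tail v = (case v of (a, b, c) \<Rightarrow> (a, b\<^sup>2, c\<^sup>2))"

definition sq_triplets :: "nat \<Rightarrow> triplet set" where
  "sq_triplets k = {(a, b, c). a \<in> \<int> \<and> b \<in> \<int> \<and> c \<in> \<int> \<and> 0 < a \<and> 0 < b \<and> 0 < c \<and>
     markov 2 k 2 a (b\<^sup>2) (c\<^sup>2)}"

definition sq_exchange :: "nat \<Rightarrow> 3 \<Rightarrow> triplet \<Rightarrow> triplet" where
  "sq_exchange k i v = (case v of (a, b, c) \<Rightarrow>
     if i = 1 then ((b^4 + real k * b\<^sup>2 * c\<^sup>2 + c^4) / a, b, c)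
     else if i = 2 then (a, (a + c\<^sup>2) / b, c)
     else (a, b, (a + b\<^sup>2) / c))"

lemma square_tail_in: "v \<in> sq_triplets k \<Longrightarrow> square_tail v \<in> markov_triplets 2 k 2"
  by (auto simp: sq_triplets_def square_tail_def markov_triplets_def)

text \<open>Squaring (a + c^2)/b yields (a^2 + 2 a c^2 + c^4)/b^2, an exchange with coefficient 2;
  likewise at the third entry.\<close>

lemma square_tail_exchange:
  "square_tail (sq_exchange k i v) = markov_exchange 2 k 2 i (square_tail v)"
  by (auto simp: sq_exchange_def square_tail_def markov_exchange_def power_divide power2_eq_square
      algebra_simps power4_eq_xxxx split: prod.splits)

lemma rational_root_Ints:
  fixes q :: real
  assumes "q \<in> \<rat>" "q\<^sup>2 \<in> \<int>"
  shows "q \<in> \<int>"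
proof -
  obtain m n where mn: "n \<noteq> (0::int)" "coprime m n" "q = of_int m / of_int n"
    using assms(1) by (metis Rats_cases' less_irrefl)
  obtain j where "q\<^sup>2 = of_int j"
    using assms(2) by (rule Ints_cases)
  moreover have "of_int m = q * of_int n"
    using mn by simp
  ultimately have "(of_int (m\<^sup>2) :: real) = of_int (j * n\<^sup>2)"
    by (simp add: power_mult_distrib)
  then have "n\<^sup>2 dvd m\<^sup>2"
    unfolding of_int_eq_iff by simp
  then have "is_unit n"
    using mn(2) by (metis coprime_absorb_right coprime_commute pow_divides_pow_iff zero_less_numeral)
  then have "n = 1 \<or> n = - 1"
    by auto
  with mn(3) show ?thesis
    by auto
qed

text \<open>Through \<open>square_tail\<close> only the squares of the new second and third entries
  are known to be integers. The entries themselves are rational by the exchange formulas, hence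
  integers.\<close>

lemma sq_exchange_closed:
  assumes "v \<in> sq_triplets k"
  shows "sq_exchange k i v \<in> sq_triplets k"
proof -
  obtain a b c where v: "v = (a, b, c)"
    by (cases v)
  obtain a' b' c' where v': "sq_exchange k i v = (a', b', c')"
    by (cases "sq_exchange k i v")
  have abc: "a \<in> \<int>" "b \<in> \<int>" "c \<in> \<int>" "0 < a" "0 < b" "0 < c"
    using assms unfolding v by (auto simp: sq_triplets_def)
  have "square_tail (sq_exchange k i v) \<in> markov_triplets 2 k 2"
    unfolding square_tail_exchange using assms by (intro markov_exchange_closed square_tail_in)
  then have sq: "a' \<in> \<int>" "b'\<^sup>2 \<in> \<int>" "c'\<^sup>2 \<in> \<int>" "markov 2 k 2 a' (b'\<^sup>2) (c'\<^sup>2)"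
    unfolding v' by (auto simp: square_tail_def markov_triplets_def)
  have "a \<in> \<rat>" "b \<in> \<rat>" "c \<in> \<rat>"
    using abc Ints_subset_Rats by auto
  then have rat: "b' \<in> \<rat>" "c' \<in> \<rat>"
    using v' unfolding v by (auto simp: sq_exchange_def split: if_splits)
  \<comment> \<open>Squaring forgets signs, so positivity is read off the quotients
    directly.\<close>
  have "0 < b^4 + real k * b\<^sup>2 * c\<^sup>2 + c^4" "0 < a + c\<^sup>2" "0 < a + b\<^sup>2"
    using abc by (simp_all add: add_pos_nonneg)
  with abc have "0 < (b^4 + real k * b\<^sup>2 * c\<^sup>2 + c^4) / a" "0 < (a + c\<^sup>2) / b"
    "0 < (a + b\<^sup>2) / c"
    by (blast intro: divide_pos_pos)+
  with abc have pos: "0 < a'" "0 < b'" "0 < c'"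
    using v' unfolding v sq_exchange_def prod.case
    by (auto split: if_splits simp del: zero_less_divide_iff)
  show ?thesis
    unfolding v' using sq pos rat [THEN rational_root_Ints] by (simp add: sq_triplets_def)
qed

lemma sq_descent:
  "descent_system (sq_triplets k) (1, 1, 1) (sq_exchange k) (max_index \<circ> square_tail)
     (entry_sum \<circ> square_tail)"
proof (rule descent_system_pullback [OF markov_descent])
  show "inj_on square_tail (sq_triplets k)"
    by (auto simp: inj_on_def square_tail_def sq_triplets_def)
  show "(1, 1, 1) \<in> sq_triplets k"
    by (simp add: sq_triplets_def markov_def)
qed (simp_all add: square_tail_in sq_exchange_closed square_tail_exchange, simp add: square_tail_def)

lemma sq_triplet_child_iff:
  assumes "v \<in> sq_triplets k"
  shows "sq_triplet_child k v w \<longleftrightarrow>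
    (\<exists>i. (v = (1, 1, 1) \<or> i \<noteq> (max_index \<circ> square_tail) v) \<and> w = sq_exchange k i v)"
proof -
  obtain a b c where abc: "v = (a, b, c)"
    by (cases v)
  have ex3: "(\<exists>i::3. P i) \<longleftrightarrow> P 1 \<or> P 2 \<or> P 3" for P
    by (metis exhaust_3)
  show ?thesis
  proof (cases "v = (1, 1, 1)")
    case True
    then show ?thesis
      by (auto simp: ex3 sq_exchange_def sq_triplet_child.simps)
  next
    case False
    have "0 < b" "0 < c"
      using assms abc by (auto simp: sq_triplets_def)
    \<comment> \<open>A positive number with square 1 is 1, so only the root is squared to the
      root.\<close>
    with False abc have "(a, b\<^sup>2, c\<^sup>2) \<noteq> (1, 1, 1)"
      by (auto simp: power2_eq_1_iff)
    then consider "b\<^sup>2 < a" "c\<^sup>2 < a" | "a < b\<^sup>2" "c\<^sup>2 < b\<^sup>2" | "a < c\<^sup>2" "b\<^sup>2 < c\<^sup>2"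
      using markov_strict_max [of a "b\<^sup>2" "c\<^sup>2"] square_tail_in [OF assms]
      unfolding abc square_tail_def by auto
    then show ?thesis
      using False unfolding ex3 abc
      by cases
        (auto simp: sq_triplet_child.simps sq_exchange_def max_index_def square_tail_def max_def)
  qed
qed


section \<open>Patterns whose seeds keep their exchange data up to sign\<close>

definition vec_of :: "triplet \<Rightarrow> real ^ 3" where
  "vec_of v = (case v of (a, b, c) \<Rightarrow> vector [a, b, c])"

lemma vec_of_inj: "vec_of v = vec_of w \<longleftrightarrow> v = w"
  by (auto simp: vec_of_def vec_eq_iff forall_3 split: prod.splits)

lemma seed_mutation_sign:
  fixes Z :: "real poly ^ ('n::{finite,linorder})"
  assumes "\<forall>i. reflect_poly (Z $ i) = Z $ i"
    and "\<forall>i. matrix_mutation i (degree (Z $ i)) B = - B"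
    and "s = (y, B', Z)" "B' = B \<or> B' = - B"
  shows "\<exists>B''. seed_mutation i s = (cluster_mutation i y B' (Z $ i), B'', Z) \<and>
    (B'' = B \<or> B'' = - B)"
proof -
  have "poly_mutation i Z = Z"
    using assms(1) by (auto simp: poly_mutation_def vec_eq_iff)
  with assms matrix_mutation_minus [of i _ B] show ?thesis
    by auto
qed

text \<open>Specialization turns mutation at \<open>i\<close> into \<open>m i\<close>, whatever the
  sign of the matrix, and so maps the regular tree equivariantly to \<open>W\<close>;
  \<open>covering_graph_iso\<close> then applies. What remains for a datum are conditions on
  \<open>B\<close>, \<open>Z\<close> and the solutions alone.\<close>

lemma pattern_gives_treeI:
  fixes V :: "'v set" and x :: "3 cluster" and B :: "3 exchange_matrix" and Z :: "real poly ^ 3"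
  assumes tree: "labeled_regular_tree V R lab" "t0 \<in> V"
    and free: "free_generating_set x" and skew: "skew_symmetrizable B"
    and d: "exchange_degrees Z = d"
    and ex: "\<forall>i. exchange_poly (Z $ i)" and palindromic: "\<forall>i. reflect_poly (Z $ i) = Z $ i"
    and sign: "\<forall>i. matrix_mutation i (degree (Z $ i)) B = - B"
    and W: "positive_solutions eqn = W"
    and desc: "descent_system W (1, 1, 1) m down height"
    and child: "\<And>v w. v \<in> W \<Longrightarrow>
      child v w \<longleftrightarrow> (\<exists>i. (v = (1, 1, 1) \<or> i \<noteq> down v) \<and> w = m i v)"
    and m: "\<And>v i. v \<in> W \<Longrightarrow>
      vec_of (m i v) = (\<chi> j. if j = i then exchange_value i (vec_of v) B (Z $ i) else vec_of v $ j)"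
  shows "pattern_gives_tree V R lab t0 x B Z d child eqn"
proof -
  interpret descent_system W "(1, 1, 1)" m down height by fact
  have W_pos: "vec_of v $ i > 0" if "v \<in> W" for v i
    using that unfolding W [symmetric] positive_solutions_def
    by (cases i rule: exhaust_3 [THEN disjE]) (auto simp: vec_of_def)
  have triplets: "triplets child = W"
    unfolding triplets_def by (rule reachable_eq [OF child])
  have edges: "(v, w) \<in> triplet_edges child \<longleftrightarrow> (\<exists>i. w = m i v)" if "v \<in> W" "w \<in> W" for v w
    using adjacent_iff [OF child that] that by (simp add: triplet_edges_def triplets)
  have "specialized_clusters_give_tree V R t0 x \<sigma> child"
    if cp: "cluster_pattern V R lab t0 (x, B, Z) \<sigma>" for \<sigma>
  proof -
    let ?p = "vector [1, 1, 1] :: real ^ 3"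
    \<comment> \<open>Specialized clusters are first handled as a relation, since their existence
      emerges only by induction along paths.\<close>
    define S where "S t v \<longleftrightarrow> v \<in> W \<and> (\<forall>i. specializes x ?p (fst (\<sigma> t) $ i) (vec_of v $ i))" for t v
    have S_unique: "v = w" if "S t v" "S t w" for t v w
      using specializes_unique [OF free] that
      unfolding S_def vec_of_inj [symmetric] vec_eq_iff by blast
    have S0: "S t0 (1, 1, 1)"
      using cp root specializes_var [of x ?p]
      by (simp add: S_def vec_of_def cluster_pattern_def)
    have S_step: "S t' (m (lab t t') v)"
      if "(t, t') \<in> R" "S t v" "\<sigma> t = (y, B', Z)" "B' = B \<or> B' = - B" for t t' v y B'
    proof -
      let ?i = "lab t t'"
      have v: "v \<in> W" "specializes x ?p (y $ j) (vec_of v $ j)" for j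
        using that by (auto simp: S_def)
      have "\<sigma> t' = seed_mutation ?i (\<sigma> t)"
        using cp that(1) by (simp add: cluster_pattern_def)
      then have "fst (\<sigma> t') = cluster_mutation ?i y B' (Z $ ?i)"
        using that(3) by simp
      moreover have "exchange_value ?i (vec_of v) B' (Z $ ?i) = exchange_value ?i (vec_of v) B (Z $ ?i)"
        using that(4) exchange_value_minus [OF palindromic [rule_format] W_pos [OF v(1)]] by auto
      moreover have "vec_of v $ j \<noteq> 0" for j
        using W_pos [OF v(1), of j] by simp
      ultimately have "specializes x ?p (fst (\<sigma> t') $ j) (vec_of (m ?i v) $ j)" for j
        using specializes_cluster_mutation [OF free v(2), of ?i B' "Z $ ?i" j]
        unfolding m [OF v(1)] vec_lambda_beta by (cases "j = ?i") simp_all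
      with closed [OF v(1)] show ?thesis
        by (simp add: S_def)
    qed
    \<comment> \<open>The induction carries the sign of the matrix together with the specialized
      values, since each mutation step uses both.\<close>
    have seeds: "\<exists>y B' v. \<sigma> t = (y, B', Z) \<and> (B' = B \<or> B' = - B) \<and> S t v" if "t \<in> V" for t
    proof -
      have "(t0, t) \<in> R\<^sup>*"
        using tree that unfolding labeled_regular_tree_def is_tree_def by blast
      then show ?thesis
      proof induction
        case base
        with S0 cp show ?case
          by (auto simp: cluster_pattern_def)
      next
        case (step t t')
        then obtain y B' v where *: "\<sigma> t = (y, B', Z)" "B' = B \<or> B' = - B" "S t v"
          by blast
        have "\<sigma> t' = seed_mutation (lab t t') (\<sigma> t)"
          using cp step by (simp add: cluster_pattern_def)
        with seed_mutation_sign [OF palindromic sign *(1,2)] S_step [OF step(2) *(3,1,2)]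
        show ?case by metis
      qed
    qed
    define \<phi> where "\<phi> t = (THE v. S t v)" for t
    have S_iff: "S t v \<longleftrightarrow> v = \<phi> t" if "t \<in> V" for t v
      using seeds [OF that] S_unique unfolding \<phi>_def by (metis the_equality)
    have iso: "graph_iso V R W (triplet_edges child) \<phi>"
    proof (rule covering_graph_iso [OF tree _ _ _ edges])
      show "\<phi> t0 = (1, 1, 1)"
        using S0 S_iff [OF tree(2)] by simp
    next
      fix t assume "t \<in> V"
      then show "\<phi> t \<in> W"
        using S_iff [of t "\<phi> t"] by (simp add: S_def)
    next
      fix t t' assume R: "(t, t') \<in> R"
      then have V: "t \<in> V" "t' \<in> V"
        using tree unfolding labeled_regular_tree_def is_tree_def by auto
      obtain y B' where "\<sigma> t = (y, B', Z)" "B' = B \<or> B' = - B"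
        using seeds [OF V(1)] by blast
      with S_step [OF R] S_iff [OF V(1)] S_iff [OF V(2)] show "\<phi> t' = m (lab t t') (\<phi> t)"
        by metis
    qed
    have spec: "case \<phi> t of (a, b, c) \<Rightarrow>
        specializes x ?p (fst (\<sigma> t) $ 1) a \<and> specializes x ?p (fst (\<sigma> t) $ 2) b \<and>
        specializes x ?p (fst (\<sigma> t) $ 3) c" if "t \<in> V" for t
      using S_iff [OF that, of "\<phi> t"]
      by (cases "\<phi> t") (auto simp: S_def forall_3 vec_of_def)
    have "\<phi> t0 = (1, 1, 1)"
      using S0 S_iff [OF tree(2)] by simp
    with iso spec show ?thesis
      unfolding specialized_clusters_give_tree_def triplets
      by (intro exI [of _ \<phi>] conjI ballI)
  qed
  then show ?thesis
    using free skew ex d W triplets by (simp add: pattern_gives_tree_def)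
qed

section \<open>Verification of the six data\<close>

lemma diagonal_skew_symmetrizable:
  fixes B :: "3 exchange_matrix" and s :: "int ^ 3"
  assumes "\<forall>i. 0 < s $ i" "\<forall>i j. s $ i * B $ i $ j = - (s $ j * B $ j $ i)"
  shows "skew_symmetrizable B"
proof -
  let ?S = "\<chi> i j. if i = j then s $ i else 0"
  have "(?S ** B) $ i $ j = s $ i * B $ i $ j" for i j
  proof -
    have "(?S ** B) $ i $ j = (\<Sum>l\<in>UNIV. if i = l then s $ i * B $ i $ j else 0)"
      unfolding matrix_matrix_mult_def vec_lambda_beta by (intro sum.cong) auto
    then show ?thesis by simp
  qed
  then have "transpose (?S ** B) = - (?S ** B)"
    unfolding vec_eq_iff transpose_def vec_lambda_beta uminus_vec_def
    using assms(2) by metis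
  moreover have "(\<forall>i j. i \<noteq> j \<longrightarrow> ?S $ i $ j = 0) \<and> (\<forall>i. 0 < ?S $ i $ i)"
    using assms(1) by simp
  ultimately show ?thesis
    unfolding skew_symmetrizable_def by blast
qed

lemma prod_3: "prod f (UNIV::3 set) = f 1 * f 2 * (f 3 :: 'a::comm_monoid_mult)"
  unfolding UNIV_3 by (simp add: mult.assoc)

lemma markov_positive_solutions:
  assumes "\<And>a b c. eqn a b c \<longleftrightarrow> a\<^sup>2 + b\<^sup>2 + c\<^sup>2 + int k1 * a * b + int k2 * b * c + int k3 * c * a
      = (3 + int k1 + int k2 + int k3) * a * b * c"
  shows "positive_solutions eqn = markov_triplets k1 k2 k3"
proof -
  have "eqn a b c \<longleftrightarrow> markov k1 k2 k3 (of_int a) (of_int b) (of_int c)" for a b c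
  proof -
    have "markov k1 k2 k3 (of_int a) (of_int b) (of_int c) \<longleftrightarrow>
      (of_int (a\<^sup>2 + b\<^sup>2 + c\<^sup>2 + int k1 * a * b + int k2 * b * c + int k3 * c * a) :: real)
      = of_int ((3 + int k1 + int k2 + int k3) * a * b * c)"
      by (simp add: markov_def)
    then show ?thesis
      unfolding of_int_eq_iff assms by (rule sym)
  qed
  then show ?thesis
    by (auto simp: positive_solutions_def markov_triplets_def elim!: Ints_cases)
qed

lemma sq_positive_solutions:
  assumes "\<And>a b c. eqn a b c \<longleftrightarrow>
      a\<^sup>2 + b^4 + c^4 + 2 * a * b\<^sup>2 + int k * b\<^sup>2 * c\<^sup>2 + 2 * c\<^sup>2 * a = (7 + int k) * a * b\<^sup>2 * c\<^sup>2"
  shows "positive_solutions eqn = sq_triplets k"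
proof -
  have "eqn a b c \<longleftrightarrow> markov 2 k 2 (of_int a) ((of_int b)\<^sup>2) ((of_int c)\<^sup>2)" for a b c
  proof -
    have "markov 2 k 2 (of_int a) ((of_int b)\<^sup>2) ((of_int c)\<^sup>2) \<longleftrightarrow>
      (of_int (a\<^sup>2 + b^4 + c^4 + 2 * a * b\<^sup>2 + int k * b\<^sup>2 * c\<^sup>2 + 2 * c\<^sup>2 * a) :: real)
      = of_int ((7 + int k) * a * b\<^sup>2 * c\<^sup>2)"
      by (simp add: markov_def flip: power_mult)
    then show ?thesis
      unfolding of_int_eq_iff assms by (rule sym)
  qed
  then show ?thesis
    by (auto simp: positive_solutions_def sq_triplets_def elim!: Ints_cases)
qed

lemma index_3_cases: "P 1 \<Longrightarrow> P 2 \<Longrightarrow> P 3 \<Longrightarrow> P (i :: 3)"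
  using exhaust_3 [of i] by auto

lemma exchange_poly_2: "exchange_poly [:1, 1:]"
  by (auto simp: exchange_poly_def coeff_pCons split: nat.splits)

lemma exchange_poly_3: "exchange_poly [:1, real k, 1:]"
  by (auto simp: exchange_poly_def coeff_pCons split: nat.splits)

lemma reflect_poly_2: "reflect_poly [:1, 1:] = [:1, 1 :: real:]"
  by (simp add: reflect_poly_def)

lemma reflect_poly_3: "reflect_poly [:1, r, 1:] = [:1, r, 1 :: real:]"
  by (simp add: reflect_poly_def)

text \<open>For the first four data this leaves finite matrix checks and the three exchange
  relations at positive real points, for one sign of \<open>B\<close> only.\<close>

lemma markov_pattern:
  fixes x :: "3 cluster" and B :: "3 exchange_matrix" and Z :: "real poly ^ 3" and s :: "int ^ 3"
  assumes "labeled_regular_tree V R lab" "t0 \<in> V" "free_generating_set x"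
    and "\<forall>i. 0 < s $ i" "\<forall>i j. s $ i * B $ i $ j = - (s $ j * B $ j $ i)"
    and "exchange_degrees Z = d" "\<forall>i. exchange_poly (Z $ i)" "\<forall>i. reflect_poly (Z $ i) = Z $ i"
    and "\<forall>i. matrix_mutation i (degree (Z $ i)) B = - B"
    and eqn: "\<forall>a b c. eqn a b c \<longleftrightarrow>
      a\<^sup>2 + b\<^sup>2 + c\<^sup>2 + int k1 * a * b + int k2 * b * c + int k3 * c * a
        = (3 + int k1 + int k2 + int k3) * a * b * c"
    and relations: "\<And>a b c. 0 < a \<Longrightarrow> 0 < b \<Longrightarrow> 0 < c \<Longrightarrow>
      exchange_value 1 (vector [a, b, c]) B (Z $ 1) = (b\<^sup>2 + real k2 * b * c + c\<^sup>2) / a \<and>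
      exchange_value 2 (vector [a, b, c]) B (Z $ 2) = (a\<^sup>2 + real k3 * a * c + c\<^sup>2) / b \<and>
      exchange_value 3 (vector [a, b, c]) B (Z $ 3) = (a\<^sup>2 + real k1 * a * b + b\<^sup>2) / c"
  shows "pattern_gives_tree V R lab t0 x B Z d (triplet_child k1 k2 k3) eqn"
proof (rule pattern_gives_treeI [OF assms(1-3) diagonal_skew_symmetrizable [OF assms(4,5)] assms(6-9)
    markov_positive_solutions markov_descent triplet_child_iff])
  fix v i assume W: "v \<in> markov_triplets k1 k2 k3"
  obtain a b c where v: "v = (a, b, c)"
    by (cases v)
  with W have "0 < a" "0 < b" "0 < c"
    by (auto simp: markov_triplets_def)
  from relations [OF this]
  show "vec_of (markov_exchange k1 k2 k3 i v) =
      (\<chi> j. if j = i then exchange_value i (vec_of v) B (Z $ i) else vec_of v $ j)"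
    unfolding v
    by (induction i rule: index_3_cases)
      (simp_all add: vec_eq_iff forall_3 vec_of_def markov_exchange_def)
qed (use eqn in auto)

lemma sq_pattern:
  fixes x :: "3 cluster" and B :: "3 exchange_matrix" and Z :: "real poly ^ 3" and s :: "int ^ 3"
  assumes "labeled_regular_tree V R lab" "t0 \<in> V" "free_generating_set x"
    and "\<forall>i. 0 < s $ i" "\<forall>i j. s $ i * B $ i $ j = - (s $ j * B $ j $ i)"
    and "exchange_degrees Z = d" "\<forall>i. exchange_poly (Z $ i)" "\<forall>i. reflect_poly (Z $ i) = Z $ i"
    and "\<forall>i. matrix_mutation i (degree (Z $ i)) B = - B"
    and eqn: "\<forall>a b c. eqn a b c \<longleftrightarrow>
      a\<^sup>2 + b^4 + c^4 + 2 * a * b\<^sup>2 + int k * b\<^sup>2 * c\<^sup>2 + 2 * c\<^sup>2 * a = (7 + int k) * a * b\<^sup>2 * c\<^sup>2"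
    and relations: "\<And>a b c. 0 < a \<Longrightarrow> 0 < b \<Longrightarrow> 0 < c \<Longrightarrow>
      exchange_value 1 (vector [a, b, c]) B (Z $ 1) = (b^4 + real k * b\<^sup>2 * c\<^sup>2 + c^4) / a \<and>
      exchange_value 2 (vector [a, b, c]) B (Z $ 2) = (a + c\<^sup>2) / b \<and>
      exchange_value 3 (vector [a, b, c]) B (Z $ 3) = (a + b\<^sup>2) / c"
  shows "pattern_gives_tree V R lab t0 x B Z d (sq_triplet_child k) eqn"
proof (rule pattern_gives_treeI [OF assms(1-3) diagonal_skew_symmetrizable [OF assms(4,5)] assms(6-9)
    sq_positive_solutions sq_descent sq_triplet_child_iff])
  fix v i assume W: "v \<in> sq_triplets k"
  obtain a b c where v: "v = (a, b, c)"
    by (cases v)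
  with W have "0 < a" "0 < b" "0 < c"
    by (auto simp: sq_triplets_def)
  from relations [OF this]
  show "vec_of (sq_exchange k i v) =
      (\<chi> j. if j = i then exchange_value i (vec_of v) B (Z $ i) else vec_of v $ j)"
    unfolding v
    by (induction i rule: index_3_cases)
      (simp_all add: vec_eq_iff forall_3 vec_of_def sq_exchange_def)
qed (use eqn in auto)

lemmas datum_simps = forall_3 vec_eq_iff exchange_degrees_def exchange_poly_2 exchange_poly_3
  reflect_poly_2 reflect_poly_3 matrix_mutation_def pos_part_def

lemmas exchange_value_3 = exchange_value_def prod_3 pos_part_def power_int_minus
  field_simps power2_eq_square power4_eq_xxxx

theorem theorem4p2:
  fixes V :: "'v set" and R :: "('v \<times> 'v) set" and lab :: "'v \<Rightarrow> 'v \<Rightarrow> 3" and t0 :: 'v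
    and x :: "3 cluster"
    and k k1 k2 k3 :: nat
  assumes "labeled_regular_tree V R lab" and "t0 \<in> V"
    and "free_generating_set x"
  shows
    "pattern_gives_tree V R lab t0 x
       (vector [vector [0, 2, -2], vector [-2, 0, 2], vector [2, -2, 0]])
       (vector [[:1, 1:], [:1, 1:], [:1, 1:]])
       (vector [1, 1, 1])
       (triplet_child 0 0 0)
       (\<lambda>x y z. x^2 + y^2 + z^2 = 3 * x * y * z) \<and>
     pattern_gives_tree V R lab t0 x
       (vector [vector [0, 2, -1], vector [-2, 0, 1], vector [2, -2, 0]])
       (vector [[:1, 1:], [:1, 1:], [:1, real k1, 1:]])
       (vector [1, 1, 2])
       (triplet_child k1 0 0)
       (\<lambda>x y z. x^2 + y^2 + z^2 + int k1 * x * y = (3 + int k1) * x * y * z) \<and>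
     pattern_gives_tree V R lab t0 x
       (vector [vector [0, 2, -1], vector [-1, 0, 1], vector [1, -2, 0]])
       (vector [[:1, real k2, 1:], [:1, 1:], [:1, real k1, 1:]])
       (vector [2, 1, 2])
       (triplet_child k1 k2 0)
       (\<lambda>x y z. x^2 + y^2 + z^2 + int k1 * x * y + int k2 * y * z
                  = (3 + int k1 + int k2) * x * y * z) \<and>
     pattern_gives_tree V R lab t0 x
       (vector [vector [0, 1, -1], vector [-1, 0, 1], vector [1, -1, 0]])
       (vector [[:1, real k2, 1:], [:1, real k3, 1:], [:1, real k1, 1:]])
       (vector [2, 2, 2])
       (triplet_child k1 k2 k3)
       (\<lambda>x y z. x^2 + y^2 + z^2 + int k1 * x * y + int k2 * y * z + int k3 * z * x
                  = (3 + int k1 + int k2 + int k3) * x * y * z) \<and>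
     pattern_gives_tree V R lab t0 x
       (vector [vector [0, 1, -1], vector [-4, 0, 2], vector [4, -2, 0]])
       (vector [[:1, 1:], [:1, 1:], [:1, 1:]])
       (vector [1, 1, 1])
       (sq_triplet_child 0)
       (\<lambda>x y z. x^2 + y^4 + z^4 + 2 * x * y^2 + 2 * z^2 * x = 7 * x * y^2 * z^2) \<and>
     pattern_gives_tree V R lab t0 x
       (vector [vector [0, 1, -1], vector [-2, 0, 2], vector [2, -2, 0]])
       (vector [[:1, real k, 1:], [:1, 1:], [:1, 1:]])
       (vector [2, 1, 1])
       (sq_triplet_child k)
       (\<lambda>x y z. x^2 + y^4 + z^4 + 2 * x * y^2 + int k * y^2 * z^2 + 2 * z^2 * x
                  = (7 + int k) * x * y^2 * z^2)"
proof (intro conjI)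
  show "pattern_gives_tree V R lab t0 x
       (vector [vector [0, 2, -2], vector [-2, 0, 2], vector [2, -2, 0]])
       (vector [[:1, 1:], [:1, 1:], [:1, 1:]])
       (vector [1, 1, 1])
       (triplet_child 0 0 0)
       (\<lambda>x y z. x^2 + y^2 + z^2 = 3 * x * y * z)"
    \<comment> \<open>The vector supplied in each case is the diagonal of a skew-symmetrizer of
      \<open>B\<close>.\<close>
    by (rule markov_pattern [OF assms, of "vector [2, 2, 2]"])
      (simp_all add: datum_simps, simp_all add: exchange_value_3)
  show "pattern_gives_tree V R lab t0 x
       (vector [vector [0, 2, -1], vector [-2, 0, 1], vector [2, -2, 0]])
       (vector [[:1, 1:], [:1, 1:], [:1, real k1, 1:]])
       (vector [1, 1, 2])
       (triplet_child k1 0 0)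
       (\<lambda>x y z. x^2 + y^2 + z^2 + int k1 * x * y = (3 + int k1) * x * y * z)"
    by (rule markov_pattern [OF assms, of "vector [2, 2, 1]"])
      (simp_all add: datum_simps, simp_all add: exchange_value_3)
  show "pattern_gives_tree V R lab t0 x
       (vector [vector [0, 2, -1], vector [-1, 0, 1], vector [1, -2, 0]])
       (vector [[:1, real k2, 1:], [:1, 1:], [:1, real k1, 1:]])
       (vector [2, 1, 2])
       (triplet_child k1 k2 0)
       (\<lambda>x y z. x^2 + y^2 + z^2 + int k1 * x * y + int k2 * y * z
                  = (3 + int k1 + int k2) * x * y * z)"
    by (rule markov_pattern [OF assms, of "vector [1, 2, 1]"])
      (simp_all add: datum_simps, simp_all add: exchange_value_3)
  show "pattern_gives_tree V R lab t0 x
       (vector [vector [0, 1, -1], vector [-1, 0, 1], vector [1, -1, 0]])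
       (vector [[:1, real k2, 1:], [:1, real k3, 1:], [:1, real k1, 1:]])
       (vector [2, 2, 2])
       (triplet_child k1 k2 k3)
       (\<lambda>x y z. x^2 + y^2 + z^2 + int k1 * x * y + int k2 * y * z + int k3 * z * x
                  = (3 + int k1 + int k2 + int k3) * x * y * z)"
    by (rule markov_pattern [OF assms, of "vector [1, 1, 1]"])
      (simp_all add: datum_simps, simp_all add: exchange_value_3)
  show "pattern_gives_tree V R lab t0 x
       (vector [vector [0, 1, -1], vector [-4, 0, 2], vector [4, -2, 0]])
       (vector [[:1, 1:], [:1, 1:], [:1, 1:]])
       (vector [1, 1, 1])
       (sq_triplet_child 0)
       (\<lambda>x y z. x^2 + y^4 + z^4 + 2 * x * y^2 + 2 * z^2 * x = 7 * x * y^2 * z^2)"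
    \<comment> \<open>With \<open>k = 0\<close> the entries 4 and -4 in the first column of
      \<open>B\<close> and the polynomial 1 + u give the numerator b^4 + c^4.\<close>
    by (rule sq_pattern [OF assms, of "vector [4, 1, 1]"])
      (simp_all add: datum_simps, simp_all add: exchange_value_3)
  show "pattern_gives_tree V R lab t0 x
       (vector [vector [0, 1, -1], vector [-2, 0, 2], vector [2, -2, 0]])
       (vector [[:1, real k, 1:], [:1, 1:], [:1, 1:]])
       (vector [2, 1, 1])
       (sq_triplet_child k)
       (\<lambda>x y z. x^2 + y^4 + z^4 + 2 * x * y^2 + int k * y^2 * z^2 + 2 * z^2 * x
                  = (7 + int k) * x * y^2 * z^2)"
    by (rule sq_pattern [OF assms, of "vector [2, 1, 1]"])
      (simp_all add: datum_simps, simp_all add: exchange_value_3)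
qed

end
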